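(* For $u,v\in S_n$, the tilted Richardson variety admits the stratification \[\mathcal{T}_{u,v}=\bigsqcup_{[x,y]\subseteq[u,v]}\mathcal{T}^\circ_{x,y},\] a disjoint union over all subintervals $[x,y]$ of the tilted Bruhat interval $[u,v]$, i.e. over all pairs $x,y\in[u,v]$ with $x\preceq y$ in the poset $[u,v]$.
   Context: $\mathrm{Fl}_n$ is the variety of complete flags in $\mathbb{C}^n$; a flag is represented by an invertible matrix whose first $k$ columns span $F_k$; $\mathrm{rank}_S(F_k)$ is the rank of the submatrix with rows $S\subseteq[n]$ and first $k$ columns. Permutations are in one-line notation, $w[k]:=\{w_1,\dots,w_k\}$; $wt_{ij}$ swaps positions $i<j$; $\ell(w)$ = number of inversions. Quantum Bruhat graph $\Gamma_n$: directed graph on $S_n$ with an edge $w\to wt_{ij}$ whenever $\ell(wt_{ij})=\ell(w)+1$ or $\ell(wt_{ij})=\ell(w)+1-2(j-i)$; $\ell(x,y)$ = shortest path length from $x$ to $y$. Tilted Bruhat interval $[u,v]:=\{w:\ell(u,w)+\ell(w,v)=\ell(u,v)\}$ with partial order $x\preceq y$ iff $\ell(u,x)+\ell(x,y)+\ell(y,v)=\ell(u,v)$. Cyclic interval $[a,b)_c$: $\{a,\dots,b-1\}$ if $a\le b$ (empty if $a=b$), $\{a,\dots,n\}\cup\{1,\dots,b-1\}$ if $a>b$. For $r\in[n]$, $<_r$ is the order $r<_r\cdots<_r n<_r1<_r\cdots<_r r-1$; for $k$-subsets $A=\{a_1<_r\cdots<_r a_k\}$, $B=\{b_1<_r\cdots<_r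 b_k\}$, $A\le_r B$ iff $a_i\le_r b_i$ for all $i$; for $\mathbf{a}\in[n]^n$, $u\le_{\mathbf{a}}v$ iff $u[k]\le_{a_k}v[k]$ for all $k$ (such $\mathbf{a}$ always exists). $\mathcal{T}_{u,v}:=\{F_\bullet:\mathrm{rank}_{[a_k,i)_c}(F_k)\le|u[k]\cap[a_k,i)_c|,\ \mathrm{rank}_{[i,a_k)_c}(F_k)\le|v[k]\cap[i,a_k)_c|\ \forall i,k\in[n]\}$ and $\mathcal{T}^\circ_{u,v}$ is defined with equalities, for any $\mathbf{a}$ with $u\le_{\mathbf{a}}v$ (independent of the choice). *)

theory Defs
  imports
    "Jordan_Normal_Form.DL_Rank_Submatrix"
    "HOL-Combinatorics.Permutations"
    "HOL-Library.FuncSet"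
    "HOL-Library.Disjoint_Sets"
begin

section \<open>The quantum Bruhat graph and tilted Bruhat intervals\<close>

text \<open>Permutations in one-line notation are functions \<open>w :: nat \<Rightarrow> nat\<close> with \<open>w permutes {1..n}\<close>;
  \<open>w k\<close> is the \<open>k\<close>-th letter and \<open>w ` {1..k}\<close> is \<open>w[k]\<close>.\<close>

definition perm_length :: "nat \<Rightarrow> (nat \<Rightarrow> nat) \<Rightarrow> nat" where
  "perm_length n w = card {(i, j). 1 \<le> i \<and> i < j \<and> j \<le> n \<and> w j < w i}"

definition quantum_bruhat_graph :: "nat \<Rightarrow> ((nat \<Rightarrow> nat) \<times> (nat \<Rightarrow> nat)) set" where
  "quantum_bruhat_graph n =
     {(w, w \<circ> transpose i j) | w i j.
        w permutes {1..n} \<and> 1 \<le> i \<and> i < j \<and> j \<le> n \<and>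
        (int (perm_length n (w \<circ> transpose i j)) = int (perm_length n w) + 1 \<or>
         int (perm_length n (w \<circ> transpose i j)) = int (perm_length n w) + 1 - 2 * (int j - int i))}"

text \<open>By \<open>quantum_bruhat_graph_strongly_connected\<close> below, the minimum is over a nonempty set
  when \<open>x\<close> and \<open>y\<close> are permutations.\<close>

definition qb_dist :: "nat \<Rightarrow> (nat \<Rightarrow> nat) \<Rightarrow> (nat \<Rightarrow> nat) \<Rightarrow> nat" where
  "qb_dist n x y = (LEAST d. (x, y) \<in> quantum_bruhat_graph n ^^ d)"

definition tilted_interval :: "nat \<Rightarrow> (nat \<Rightarrow> nat) \<Rightarrow> (nat \<Rightarrow> nat) \<Rightarrow> (nat \<Rightarrow> nat) set" where
  "tilted_interval n u v =
     {w. w permutes {1..n} \<and> qb_dist n u w + qb_dist n w v = qb_dist n u v}"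

definition tilted_le ::
  "nat \<Rightarrow> (nat \<Rightarrow> nat) \<Rightarrow> (nat \<Rightarrow> nat) \<Rightarrow> (nat \<Rightarrow> nat) \<Rightarrow> (nat \<Rightarrow> nat) \<Rightarrow> bool" where
  "tilted_le n u v x y \<longleftrightarrow> qb_dist n u x + qb_dist n x y + qb_dist n y v = qb_dist n u v"

section \<open>Cyclic intervals and shifted orders\<close>

definition cyc_interval :: "nat \<Rightarrow> nat \<Rightarrow> nat \<Rightarrow> nat set" where
  "cyc_interval n a b = (if a \<le> b then {a..<b} else {a..n} \<union> {1..<b})"

text \<open>The position, counted from \<open>0\<close>, of \<open>i\<close> in the sequence \<open>r, r + 1, \<dots>, n, 1, \<dots>, r - 1\<close>;
  thus \<open>i <\<^sub>r j\<close> iff \<open>cyc_pos n r i < cyc_pos n r j\<close>.\<close>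

definition cyc_pos :: "nat \<Rightarrow> nat \<Rightarrow> nat \<Rightarrow> nat" where
  "cyc_pos n r i = (if r \<le> i then i - r else n + i - r)"

definition subset_le :: "nat \<Rightarrow> nat \<Rightarrow> nat set \<Rightarrow> nat set \<Rightarrow> bool" where
  "subset_le n r A B \<longleftrightarrow>
     list_all2 (\<lambda>a b. cyc_pos n r a \<le> cyc_pos n r b)
       (sorted_key_list_of_set (cyc_pos n r) A) (sorted_key_list_of_set (cyc_pos n r) B)"

definition perm_le :: "nat \<Rightarrow> (nat \<Rightarrow> nat) \<Rightarrow> (nat \<Rightarrow> nat) \<Rightarrow> (nat \<Rightarrow> nat) \<Rightarrow> bool" where
  "perm_le n a u v \<longleftrightarrow> (\<forall>k\<in>{1..n}. subset_le n (a k) (u ` {1..k}) (v ` {1..k}))"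

text \<open>Some vector \<open>a\<close> with \<open>u \<le>\<^sub>a v\<close>. One exists by lemma \<open>choose_shift\<close> below; the varieties
  defined from it do not depend on which one is taken.\<close>

definition choose_shift :: "nat \<Rightarrow> (nat \<Rightarrow> nat) \<Rightarrow> (nat \<Rightarrow> nat) \<Rightarrow> nat \<Rightarrow> nat" where
  "choose_shift n u v = (SOME a. a \<in> {1..n} \<rightarrow> {1..n} \<and> perm_le n a u v)"

section \<open>Complete flags in complex n-space\<close>

text \<open>\<open>F k\<close> is the \<open>k\<close>-dimensional member of the flag, for \<open>k \<le> n\<close>.\<close>

definition complete_flags :: "nat \<Rightarrow> (nat \<Rightarrow> complex vec set) set" where
  "complete_flags n =
     {F \<in> extensional {..n}.
        (\<forall>k\<le>n. VectorSpace.subspace class_ring (F k) (module_vec TYPE(complex) n) \<and>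
          vectorspace.dim class_ring ((module_vec TYPE(complex) n)\<lparr>carrier := F k\<rparr>) = k) \<and>
        (\<forall>k<n. F k \<subseteq> F (Suc k))}"

definition represents_flag :: "nat \<Rightarrow> complex mat \<Rightarrow> (nat \<Rightarrow> complex vec set) \<Rightarrow> bool" where
  "represents_flag n M F \<longleftrightarrow>
     M \<in> carrier_mat n n \<and> invertible_mat M \<and>
     (\<forall>k\<le>n. F k = LinearCombinations.module.span class_ring (module_vec TYPE(complex) n)
                    (set (take k (cols M))))"

text \<open>Matrix rows and columns are indexed from \<open>0\<close>, whereas \<open>S\<close> is a subset of \<open>{1..n}\<close>.\<close>

definition submatrix_rank :: "nat set \<Rightarrow> nat \<Rightarrow> complex mat \<Rightarrow> nat" where
  "submatrix_rank S k M = (let N = submatrix M {i. Suc i \<in> S} {..<k} in vec_space.rank (dim_row N) N)"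

text \<open>Representing matrices exist by \<open>represents_flag_exists\<close>, and by \<open>flag_rank_eq\<close> the rank
  is the same for all of them.\<close>

definition flag_rank :: "nat \<Rightarrow> nat set \<Rightarrow> (nat \<Rightarrow> complex vec set) \<Rightarrow> nat \<Rightarrow> nat" where
  "flag_rank n S F k = submatrix_rank S k (SOME M. represents_flag n M F)"

section \<open>Tilted Richardson varieties\<close>

definition tilted_richardson ::
  "nat \<Rightarrow> (nat \<Rightarrow> nat) \<Rightarrow> (nat \<Rightarrow> nat) \<Rightarrow> (nat \<Rightarrow> complex vec set) set" where
  "tilted_richardson n u v =
     (let a = choose_shift n u v in
      {F \<in> complete_flags n. \<forall>i\<in>{1..n}. \<forall>k\<in>{1..n}.
         flag_rank n (cyc_interval n (a k) i) F k \<le> card (u ` {1..k} \<inter> cyc_interval n (a k) i) \<and>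
         flag_rank n (cyc_interval n i (a k)) F k \<le> card (v ` {1..k} \<inter> cyc_interval n i (a k))})"

definition open_tilted_richardson ::
  "nat \<Rightarrow> (nat \<Rightarrow> nat) \<Rightarrow> (nat \<Rightarrow> nat) \<Rightarrow> (nat \<Rightarrow> complex vec set) set" where
  "open_tilted_richardson n u v =
     (let a = choose_shift n u v in
      {F \<in> complete_flags n. \<forall>i\<in>{1..n}. \<forall>k\<in>{1..n}.
         flag_rank n (cyc_interval n (a k) i) F k = card (u ` {1..k} \<inter> cyc_interval n (a k) i) \<and>
         flag_rank n (cyc_interval n i (a k)) F k = card (v ` {1..k} \<inter> cyc_interval n i (a k))})"

section \<open>Well-definedness of the distances and choices above\<close>

lemma adjacent_edge:
  assumes w: "w permutes {1..n}" and i: "1 \<le> i" "Suc i \<le> n"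
  shows "(w, w \<circ> transpose i (Suc i)) \<in> quantum_bruhat_graph n"
proof -
  define s where "s = transpose i (Suc i)"
  define ivs where "ivs w = {(a, b). 1 \<le> a \<and> a < b \<and> b \<le> n \<and> w b < (w a :: nat)}" for w
  have fin: "finite (ivs w)" for w
    by (rule finite_subset[of _ "{..n} \<times> {..n}"]) (auto simp: ivs_def)
  have s_le: "1 \<le> s a \<longleftrightarrow> 1 \<le> a" "s a \<le> n \<longleftrightarrow> a \<le> n" for a
    using i by (auto simp: s_def transpose_def)
  have s_lt: "s a < s b" if "a < b" "(a, b) \<noteq> (i, Suc i)" for a b
    using that by (auto simp: s_def transpose_def)
  have s_ne: "(s a, s b) \<noteq> (i, Suc i)" if "a < b" for a b
    using that by (auto simp: s_def transpose_def split: if_splits)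
  have ss: "s (s a) = a" for a by (simp add: s_def)
  have "bij_betw (map_prod s s) (ivs (w \<circ> s) - {(i, Suc i)}) (ivs w - {(i, Suc i)})"
    by (rule bij_betw_byWitness[where f' = "map_prod s s"])
       (use s_le s_lt s_ne ss in \<open>auto simp: ivs_def\<close>)
  then have eq: "card (ivs (w \<circ> s) - {(i, Suc i)}) = card (ivs w - {(i, Suc i)})"
    by (rule bij_betw_same_card)
  have ne: "w i \<noteq> w (Suc i)" using permutes_inj[OF w] by (metis injD n_not_Suc_n)
  have mem: "(i, Suc i) \<in> ivs w \<longleftrightarrow> w (Suc i) < w i"
    "(i, Suc i) \<in> ivs (w \<circ> s) \<longleftrightarrow> w i < w (Suc i)"
    using i by (auto simp: ivs_def s_def)
  have "card (ivs (w \<circ> s)) = Suc (card (ivs w)) \<or> Suc (card (ivs (w \<circ> s))) = card (ivs w)"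
  proof (cases "w (Suc i) < w i")
    case True
    then have "ivs (w \<circ> s) - {(i, Suc i)} = ivs (w \<circ> s)" using mem by auto
    then show ?thesis using True mem eq fin[of w] by (metis card_Suc_Diff1)
  next
    case False
    then have "ivs w - {(i, Suc i)} = ivs w" "(i, Suc i) \<in> ivs (w \<circ> s)" using mem ne by auto
    then show ?thesis using eq fin[of "w \<circ> s"] by (metis card_Suc_Diff1)
  qed
  then have "perm_length n (w \<circ> s) = Suc (perm_length n w) \<or> Suc (perm_length n (w \<circ> s)) = perm_length n w"
    by (simp add: perm_length_def ivs_def)
  then show ?thesis using w i unfolding quantum_bruhat_graph_def s_def by fastforce
qed

lemma quantum_bruhat_graph_strongly_connected:
  assumes x: "x permutes {1..n}" and y: "y permutes {1..n}"
  shows "\<exists>d. (x, y) \<in> quantum_bruhat_graph n ^^ d"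
proof -
  let ?E = "(quantum_bruhat_graph n)\<^sup>*"
  have swap: "w permutes {1..n} \<Longrightarrow> 1 \<le> i \<Longrightarrow> i + Suc d \<le> n \<Longrightarrow> (w, w \<circ> transpose i (i + Suc d)) \<in> ?E"
    for w i d
  proof (induction d arbitrary: w)
    case 0
    then have "(w, w \<circ> transpose i (Suc i)) \<in> quantum_bruhat_graph n"
      by (intro adjacent_edge) auto
    then show ?case unfolding add_Suc_right add_0_right by (rule r_into_rtrancl)
  next
    case (Suc d)
    define j where "j = i + Suc d"
    let ?s = "transpose j (Suc j)"
    have j: "1 \<le> j" "Suc j \<le> n" "i < j" using Suc.prems by (auto simp: j_def)
    have sp: "?s permutes {1..n}" "transpose i j permutes {1..n}"
      using j Suc.prems by (auto intro!: permutes_swap_id)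
    have p1: "w \<circ> ?s permutes {1..n}" by (rule permutes_compose[OF sp(1) Suc.prems(1)])
    have p2: "w \<circ> ?s \<circ> transpose i j permutes {1..n}" by (rule permutes_compose[OF sp(2) p1])
    have "(w, w \<circ> ?s) \<in> ?E" using adjacent_edge[OF Suc.prems(1) j(1,2)] by blast
    also have "(w \<circ> ?s, w \<circ> ?s \<circ> transpose i j) \<in> ?E"
      unfolding j_def by (rule Suc.IH[OF p1[unfolded j_def]]) (use Suc.prems in simp_all)
    also have "(w \<circ> ?s \<circ> transpose i j, w \<circ> ?s \<circ> transpose i j \<circ> ?s) \<in> ?E"
      using adjacent_edge[OF p2 j(1,2)] by blast
    also have "w \<circ> ?s \<circ> transpose i j \<circ> ?s = w \<circ> transpose i (i + Suc (Suc d))"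
      using j by (auto simp: fun_eq_iff transpose_def j_def)
    finally show ?case .
  qed
  have swap': "(w, w \<circ> transpose i j) \<in> ?E" if "w permutes {1..n}" "i \<in> {1..n}" "j \<in> {1..n}" for w i j
  proof -
    consider "i = j" | "i < j" | "j < i" by linarith
    then show ?thesis
    proof cases
      case 2
      then show ?thesis using swap[OF that(1), of i "j - i - 1"] that by simp
    next
      case 3
      then show ?thesis using swap[OF that(1), of j "i - j - 1"] that by (simp add: transpose_commute)
    qed auto
  qed
  have "(x, x \<circ> p) \<in> ?E" if "p permutes {1..n}" for p
    using finite_atLeastAtMost that
  proof (induction rule: permutes_rev_induct)
    case (swap a b p)
    have "x \<circ> p permutes {1..n}" by (rule permutes_compose[OF swap(4) x])
    then have "(x \<circ> p, x \<circ> p \<circ> transpose a b) \<in> ?E" by (rule swap') (use swap in auto)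
    with swap(5) show ?case unfolding comp_assoc by (rule rtrancl_trans)
  qed simp
  from this[of "Hilbert_Choice.inv x \<circ> y"] have "(x, y) \<in> ?E"
    using x y permutes_compose[OF y permutes_inv[OF x]] permutes_inv_o(1)[OF x]
    by (simp add: comp_assoc[symmetric])
  then show ?thesis by (metis rtrancl_power)
qed

lemma sorted_list_le_of_counts:
  fixes X Y :: "nat set"
  assumes "finite X" "finite Y" "card X = card Y"
    and cnt: "\<And>t. card (Y \<inter> {..<t}) \<le> card (X \<inter> {..<t})"
  shows "list_all2 (\<le>) (sorted_list_of_set X) (sorted_list_of_set Y)"
proof (rule list_all2_all_nthI)
  show "length (sorted_list_of_set X) = length (sorted_list_of_set Y)" using assms by simp
  fix i assume i: "i < length (sorted_list_of_set X)"
  define xs where "xs = sorted_list_of_set X"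
  define ys where "ys = sorted_list_of_set Y"
  have l: "i < length xs" "i < length ys" using i assms by (auto simp: xs_def ys_def)
  have sx: "sorted_wrt (<) xs" "sorted_wrt (<) ys" by (auto simp: xs_def ys_def)
  have X: "set xs = X" "set ys = Y" using assms by (auto simp: xs_def ys_def)
  have dx: "distinct xs" "distinct ys" by (auto simp: xs_def ys_def)
  show "sorted_list_of_set X ! i \<le> sorted_list_of_set Y ! i"
  proof (rule ccontr)
    assume "\<not> ?thesis"
    then have gt: "ys ! i < xs ! i" by (simp add: xs_def ys_def)
    define t where "t = Suc (ys ! i)"
    have "(!) ys ` {..i} \<subseteq> Y \<inter> {..<t}"
      using l X sx(2) by (auto simp: t_def less_Suc_eq_le sorted_wrt_iff_nth_less)
         (metis le_eq_less_or_eq order_refl)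
    then have "card ((!) ys ` {..i}) \<le> card (Y \<inter> {..<t})"
      using assms(2) by (intro card_mono) auto
    moreover have "card ((!) ys ` {..i}) = Suc i"
      using dx l by (subst card_image) (auto simp: inj_on_def nth_eq_iff_index_eq)
    moreover have "X \<inter> {..<t} \<subseteq> (!) xs ` {..<i}"
    proof
      fix z assume z: "z \<in> X \<inter> {..<t}"
      then obtain j where j: "j < length xs" "z = xs ! j" using X by (metis IntD1 in_set_conv_nth)
      have "j < i"
      proof (rule ccontr)
        assume "\<not> j < i"
        then have "xs ! i \<le> xs ! j" using sx(1) j by (metis le_eq_less_or_eq linorder_not_less sorted_wrt_nth_less)
        then show False using z j gt by (auto simp: t_def)
      qed
      then show "z \<in> (!) xs ` {..<i}" using j by auto
    qed
    then have "card (X \<inter> {..<t}) \<le> card ((!) xs ` {..<i})" by (intro card_mono) auto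
    moreover have "card ((!) xs ` {..<i}) \<le> i" using card_image_le[of "{..<i}"] by simp
    ultimately show False using cnt[of t] by simp
  qed
qed

lemma cyc_pos_inj: "r \<in> {1..n} \<Longrightarrow> inj_on (cyc_pos n r) {1..n}"
  by (auto simp: inj_on_def cyc_pos_def split: if_splits)

lemma (in linorder) map_sorted_key_list_of_set:
  assumes "inj_on f A" "finite A"
  shows "map f (sorted_key_list_of_set f A) = sorted_list_of_set (f ` A)"
proof -
  interpret folding_insort_key "(\<le>)" "(<)" A f by unfold_locales (rule assms(1))
  have 1: "sorted (map f (sorted_key_list_of_set f A))"
    by (rule sorted_sorted_key_list_of_set[OF subset_refl])
  have 2: "set (sorted_key_list_of_set f A) = A"
    by (rule set_sorted_key_list_of_set[OF subset_refl assms(2)])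
  have 3: "distinct (map f (sorted_key_list_of_set f A))"
    by (rule distinct_sorted_key_list_of_set[OF subset_refl])
  show ?thesis
    using sorted_list_of_set.idem_if_sorted_distinct[OF 1 3] 2 by (metis list.set_map)
qed

lemma map_cyc_pos_sorted:
  assumes "r \<in> {1..n}" "A \<subseteq> {1..n}"
  shows "map (cyc_pos n r) (sorted_key_list_of_set (cyc_pos n r) A) = sorted_list_of_set (cyc_pos n r ` A)"
  using inj_on_subset[OF cyc_pos_inj[OF assms(1)] assms(2)] finite_subset[OF assms(2)]
  by (intro map_sorted_key_list_of_set) auto

lemma exists_shift:
  assumes A: "A \<subseteq> {1..n}" and B: "B \<subseteq> {1..n}" and c: "card A = card B" and n: "1 \<le> n"
  shows "\<exists>r\<in>{1..n}. subset_le n r A B"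
proof -
  have fin: "finite A" "finite B" using A B finite_subset by blast+
  define g where "g t = int (card (A \<inter> {1..t})) - int (card (B \<inter> {1..t}))" for t
  have g0: "g 0 = 0" by (simp add: g_def)
  have gn: "g n = 0" using A B c by (simp add: g_def Int_absorb2)
  obtain t0 where t0: "t0 < n" "\<And>t. t < n \<Longrightarrow> g t0 \<le> g t"
    using ex_min_if_finite[of "g ` {..<n}"] n
    by (metis (mono_tags, lifting) lessThan_iff finite_lessThan lessThan_empty_iff not_one_le_zero
        arg_min_if_finite(1) arg_min_least)
  have t0n: "g t0 \<le> g t" if "t \<le> n" for t
    using t0(2)[of t] t0(2)[of 0] n that g0 gn by (cases "t = n") auto
  define r where "r = Suc t0"
  have r: "r \<in> {1..n}" using t0 by (auto simp: r_def)
  have split: "int (card (Z \<inter> {r..t})) = int (card (Z \<inter> {1..t})) - int (card (Z \<inter> {1..t0}))"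
    if "t0 \<le> t" for Z t
  proof -
    have "Z \<inter> {1..t} = (Z \<inter> {1..t0}) \<union> (Z \<inter> {r..t})" using that by (auto simp: r_def)
    then show ?thesis by (simp add: card_Un_disjoint r_def disjoint_iff)
  qed
  have img: "card (cyc_pos n r ` Z \<inter> {..<t}) =
     (if t0 + t \<le> n then card (Z \<inter> {r..t0 + t})
      else if t < n then card (Z \<inter> {r..n}) + card (Z \<inter> {1..t0 + t - n}) else card Z)"
    if Z: "Z \<subseteq> {1..n}" for Z t
  proof -
    have fz: "finite Z" using Z finite_subset by blast
    have "cyc_pos n r ` Z \<inter> {..<t} = cyc_pos n r ` {z\<in>Z. cyc_pos n r z < t}" by auto
    moreover have "card (cyc_pos n r ` {z\<in>Z. cyc_pos n r z < t}) = card {z\<in>Z. cyc_pos n r z < t}"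
      by (intro card_image inj_on_subset[OF cyc_pos_inj[OF r]]) (use Z in auto)
    moreover have "{z\<in>Z. cyc_pos n r z < t} =
       (if t0 + t \<le> n then Z \<inter> {r..t0 + t}
        else if t < n then (Z \<inter> {r..n}) \<union> (Z \<inter> {1..t0 + t - n}) else Z)"
      using Z t0(1) r by (auto simp: cyc_pos_def r_def split: if_splits) (force+)?
    moreover have "card ((Z \<inter> {r..n}) \<union> (Z \<inter> {1..t0 + t - n})) = card (Z \<inter> {r..n}) + card (Z \<inter> {1..t0 + t - n})"
      if "t < n" using that by (intro card_Un_disjoint) (auto simp: r_def)
    ultimately show ?thesis by simp
  qed
  have cnt: "card (cyc_pos n r ` B \<inter> {..<t}) \<le> card (cyc_pos n r ` A \<inter> {..<t})" for t
  proof -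
    consider "t0 + t \<le> n" | "t0 + t > n" "t < n" | "t0 + t > n" "t \<ge> n" by linarith
    then show ?thesis
    proof cases
      case 1
      then show ?thesis using t0n[of "t0 + t"] split[of "t0 + t" A] split[of "t0 + t" B]
        by (simp add: img[OF A] img[OF B] g_def)
    next
      case 2
      then have "t0 + t - n \<le> n" using t0(1) by linarith
      then show ?thesis using 2 t0n[of "t0 + t - n"] split[of n A] split[of n B] t0(1) gn
        by (simp add: img[OF A] img[OF B] g_def)
    next
      case 3
      then show ?thesis by (simp add: img[OF A] img[OF B] c)
    qed
  qed
  have cards: "card (cyc_pos n r ` A) = card (cyc_pos n r ` B)"
    using c card_image[OF inj_on_subset[OF cyc_pos_inj[OF r] A]]
      card_image[OF inj_on_subset[OF cyc_pos_inj[OF r] B]] by simp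
  have "subset_le n r A B"
    using sorted_list_le_of_counts[OF _ _ cards cnt] fin
    unfolding map_cyc_pos_sorted[OF r A, symmetric] map_cyc_pos_sorted[OF r B, symmetric]
    by (simp add: subset_le_def list_all2_map1 list_all2_map2)
  then show ?thesis using r by blast
qed

lemma choose_shift:
  assumes "u permutes {1..n}" "v permutes {1..n}"
  shows "choose_shift n u v \<in> {1..n} \<rightarrow> {1..n}" "perm_le n (choose_shift n u v) u v"
proof -
  have "\<exists>r\<in>{1..n}. subset_le n r (u ` {1..k}) (v ` {1..k})" if k: "k \<in> {1..n}" for k
  proof (rule exists_shift)
    have sub: "{1..k} \<subseteq> {1..n}" using k by auto
    show "u ` {1..k} \<subseteq> {1..n}" "v ` {1..k} \<subseteq> {1..n}"
      using permutes_image[OF assms(1)] permutes_image[OF assms(2)] sub by blast+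
    show "card (u ` {1..k}) = card (v ` {1..k})"
      using permutes_inj_on[OF assms(1)] permutes_inj_on[OF assms(2)] by (simp add: card_image)
  qed (use k in auto)
  then obtain a where "\<And>k. k \<in> {1..n} \<Longrightarrow> a k \<in> {1..n} \<and> subset_le n (a k) (u ` {1..k}) (v ` {1..k})"
    by metis
  then have "\<exists>a. a \<in> {1..n} \<rightarrow> {1..n} \<and> perm_le n a u v"
    by (intro exI[of _ a]) (auto simp: perm_le_def)
  from someI_ex[OF this] show "choose_shift n u v \<in> {1..n} \<rightarrow> {1..n}" "perm_le n (choose_shift n u v) u v"
    by (auto simp: choose_shift_def)
qed

lemma (in vec_space) subspace_basis_exists:
  assumes W: "VectorSpace.subspace class_ring W V"
  obtains B where "finite B" "B \<subseteq> W" "lin_indpt B" "span B = W"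
    "card B = vectorspace.dim class_ring (vs W)"
proof -
  have sm: "submodule class_ring W V" using W by simp
  have Wc: "W \<subseteq> carrier_vec n" using sm by (simp add: submodule_def)
  interpret W: vectorspace class_ring "vs W" using W by (rule subspace_is_vs)
  have bound: "finite S \<and> card S \<le> dim" if "S \<subseteq> W \<and> lin_indpt S" for S
  proof -
    have S: "S \<subseteq> carrier_vec n" and li: "lin_indpt S" using that Wc by auto
    show ?thesis by (rule conjI[OF li_le_dim(1)[OF fin_dim S li] li_le_dim(2)[OF fin_dim S li]])
  qed
  obtain B where fB: "finite B" and mB: "maximal B (\<lambda>S. S \<subseteq> W \<and> lin_indpt S)"
  proof -
    have empty: "{} \<subseteq> W \<and> lin_indpt {}" using finite_lin_indpt2[of "{}"] by auto
    have "\<exists>B. finite B \<and> maximal B (\<lambda>S. S \<subseteq> W \<and> lin_indpt S)"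
      by (rule maximal_exists[where N = dim and B = "{}"]) (rule bound, assumption, rule empty)
    then show ?thesis by (elim exE conjE) (rule that)
  qed
  have iff: "W.lin_dep S = lin_dep S" if "S \<subseteq> W" for S
    using span_li_not_depend(2)[OF that sm] .
  have "maximal B (\<lambda>S. S \<subseteq> carrier (vs W) \<and> W.lin_indpt S)"
    using mB iff unfolding maximal_def carrier_vs_is_self by metis
  then have B: "W.basis B" by (rule W.max_li_is_basis)
  then have BW: "B \<subseteq> W" by (simp add: W.basis_def)
  from B fB W.dim_basis have "card B = W.dim" by simp
  moreover have "lin_indpt B" "span B = W"
    using B span_li_not_depend[OF BW sm] by (auto simp: W.basis_def)
  ultimately show ?thesis using that fB BW by blast
qed

lemma (in vec_space) span_eq_subspace:
  assumes W: "VectorSpace.subspace class_ring W V" and S: "finite S" "S \<subseteq> W" "lin_indpt S"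
    and c: "card S = vectorspace.dim class_ring (vs W)"
  shows "span S = W"
proof -
  have sm: "submodule class_ring W V" using W by simp
  interpret W: vectorspace class_ring "vs W" using W by (rule subspace_is_vs)
  obtain B where B: "finite B" "B \<subseteq> W" "span B = W" using subspace_basis_exists[OF W] by metis
  have fd: "W.fin_dim"
    using B span_li_not_depend(1)[OF B(2) sm] by (auto simp: W.fin_dim_def)
  have "W.basis S"
    using span_li_not_depend(2)[OF S(2) sm] S c by (intro W.dim_li_is_basis[OF fd]) auto
  then show ?thesis using span_li_not_depend(1)[OF S(2) sm] by (simp add: W.basis_def)
qed

lemma represents_flag_exists:
  assumes F: "F \<in> complete_flags n"
  shows "\<exists>M. represents_flag n M F"
proof -
  interpret vec_space "TYPE(complex)" n .
  have sub: "VectorSpace.subspace class_ring (F k) V" and dimF: "vectorspace.dim class_ring (vs (F k)) = k"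
    if "k \<le> n" for k
    using F that by (auto simp: complete_flags_def)
  have inc: "F k \<subseteq> F (Suc k)" if "k < n" for k using F that by (auto simp: complete_flags_def)
  have Fc: "F k \<subseteq> carrier_vec n" if "k \<le> n" for k
    using sub[OF that] by (auto simp: VectorSpace.subspace_def submodule_def)
  have "\<exists>xs. length xs = k \<and> distinct xs \<and> set xs \<subseteq> F k \<and> lin_indpt (set xs) \<and>
         (\<forall>j\<le>k. span (set (take j xs)) = F j)" if "k \<le> n" for k
    using that
  proof (induction k)
    case 0
    obtain B where "finite B" "lin_indpt B" "span B = F 0" "card B = 0"
      using subspace_basis_exists[OF sub[of 0]] dimF[of 0] by auto
    then show ?case by (intro exI[of _ "[]"]) auto
  next
    case (Suc k)
    then obtain xs where xs: "length xs = k" "distinct xs" "set xs \<subseteq> F k" "lin_indpt (set xs)"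
      "\<And>j. j \<le> k \<Longrightarrow> span (set (take j xs)) = F j" by auto
    have k: "k < n" using Suc by simp
    have "F k \<noteq> F (Suc k)" using dimF[of k] dimF[of "Suc k"] k by auto
    then obtain v where v: "v \<in> F (Suc k)" "v \<notin> F k" using inc[OF k] by blast
    have sp: "span (set xs) = F k" using xs(5)[of k] xs(1) by simp
    have vx: "v \<notin> set xs" using v xs by auto
    have ind: "lin_indpt (insert v (set xs))"
      using lin_dep_iff_in_span[of "set xs" v] xs(3,4) vx v sp Fc[of k] Fc[of "Suc k"] k by auto
    have "span (insert v (set xs)) = F (Suc k)"
      using xs vx v inc[OF k] dimF[of "Suc k"] k distinct_card[OF xs(2)]
      by (intro span_eq_subspace[OF sub _ _ ind]) auto
    then have "span (set (take j (xs @ [v]))) = F j" if "j \<le> Suc k" for j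
      using that xs by (cases "j = Suc k") auto
    then show ?case
      using xs vx v inc[OF k] ind by (intro exI[of _ "xs @ [v]"]) auto
  qed
  then obtain xs where xs: "length xs = n" "distinct xs" "set xs \<subseteq> F n" "lin_indpt (set xs)"
    "\<And>j. j \<le> n \<Longrightarrow> span (set (take j xs)) = F j" by blast
  define M where "M = mat_of_cols n xs"
  have M: "M \<in> carrier_mat n n" using xs(1) by (auto simp: M_def)
  have cM: "cols M = xs" using xs(3) Fc[of n] by (simp add: M_def)
  have "rank M = n" using lin_indpt_full_rank[OF M] xs cM by simp
  then have "det M \<noteq> 0" using det_rank_iff[OF M] by simp
  then obtain N where "N \<in> carrier_mat n n" "N * M = 1\<^sub>m n" "M * N = 1\<^sub>m n"
    using det_non_zero_imp_unit[OF M, of undefined] by (auto simp: Units_def ring_mat_def)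
  then have "invertible_mat M" using M by (auto simp: invertible_mat_def inverts_mat_def)
  then show ?thesis using M xs cM by (auto simp: represents_flag_def)
qed

lemma submatrix_rank_well_defined:
  assumes "represents_flag n M F" "represents_flag n M' F" "k \<le> n"
  shows "submatrix_rank S k M = submatrix_rank S k M'"
proof -
  define I where "I = {i. Suc i \<in> S}"
  define r where "r = card {i. i < n \<and> i \<in> I}"
  interpret n: vec_space "TYPE(complex)" n .
  interpret r: vec_space "TYPE(complex)" r .
  define sel where "sel y = vec r (\<lambda>i. y $ pick I i)" for y :: "complex vec"
  have main: "submatrix_rank S k A = vectorspace.dim class_ring (r.vs (sel ` F k))"
    if A: "represents_flag n A F" for A
  proof -
    have Ac: "A \<in> carrier_mat n n" using A by (simp add: represents_flag_def)
    define Ak where "Ak = mat_of_cols n (take k (cols A))"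
    define N where "N = submatrix A I {..<k}"
    have dA: "dim_row A = n" "dim_col A = n" using Ac by auto
    have set: "{j. j < n \<and> j \<in> {..<k}} = {..<k}" using assms(3) by auto
    have N: "N \<in> carrier_mat r k"
    proof (rule carrier_matI)
      show "dim_row N = r" unfolding N_def dim_submatrix dA r_def ..
      show "dim_col N = k" unfolding N_def dim_submatrix dA set card_lessThan ..
    qed
    have Ak: "Ak \<in> carrier_mat n k" using Ac assms(3) by (auto simp: Ak_def)
    have cAk: "cols Ak = take k (cols A)"
      unfolding Ak_def using Ac by (intro cols_mat_of_cols) (metis cols_dim carrier_matD(1) set_take_subset subset_trans)
    have pk: "pick {..<k} j = j" if "j < k" for j
    proof -
      have "{a \<in> {..<k}. a < j} = {..<j}" using that by auto
      then show ?thesis using that pick_card_in_set[of j "{..<k}"] by simp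
    qed
    have pI: "pick I i < n" if "i < r" for i
      using that pick_le[of i n I] by (simp add: r_def)
    have mult: "N *\<^sub>v x = sel (Ak *\<^sub>v x)" if x: "x \<in> carrier_vec k" for x
    proof (rule eq_vecI)
      fix i assume "i < dim_vec (sel (Ak *\<^sub>v x))"
      then have i: "i < r" by (simp add: sel_def)
      have "row N i = row Ak (pick I i)"
      proof (rule eq_vecI)
        fix j assume "j < dim_vec (row Ak (pick I i))"
        then have j: "j < k" using Ak by simp
        have "N $$ (i, j) = A $$ (pick I i, j)"
          using i j submatrix_index[of i A I j "{..<k}"]
          unfolding N_def dA set pk[OF j] r_def card_lessThan by blast
        moreover have "Ak $$ (pick I i, j) = A $$ (pick I i, j)"
          using j Ac assms(3) pI[OF i] by (simp add: Ak_def mat_of_cols_index)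
        ultimately show "row N i $ j = row Ak (pick I i) $ j"
          using i j N Ak pI[OF i] by simp
      qed (use N Ak in auto)
      then show "(N *\<^sub>v x) $ i = sel (Ak *\<^sub>v x) $ i"
        using i N Ak pI[OF i] by (simp add: sel_def)
    qed (use N in \<open>simp add: sel_def\<close>)
    have Nx: "N *\<^sub>v x \<in> carrier_vec r" and Akx: "Ak *\<^sub>v x \<in> carrier_vec n" if "x \<in> carrier_vec k" for x
      using N Ak that by (auto intro: mult_mat_vec_carrier)
    have dims: "dim_row N = r" "dim_col N = k" "dim_row Ak = n" "dim_col Ak = k"
      using N Ak by auto
    have 1: "r.span (set (cols N)) = (\<lambda>x. N *\<^sub>v x) ` carrier_vec k"
      unfolding r.col_space_eq[OF N, unfolded r.col_space_def dims] using Nx by blast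
    have 2: "n.span (set (cols Ak)) = (\<lambda>x. Ak *\<^sub>v x) ` carrier_vec k"
      unfolding n.col_space_eq[OF Ak, unfolded n.col_space_def dims] using Akx by blast
    have "r.span (set (cols N)) = sel ` n.span (set (cols Ak))"
      unfolding 1 2 image_image using mult by (intro image_cong) auto
    also have "n.span (set (cols Ak)) = F k"
      using A assms(3) by (simp add: cAk represents_flag_def)
    finally show ?thesis
      using N by (simp add: submatrix_rank_def Let_def I_def[symmetric] N_def[symmetric] r.rank_def)
  qed
  show ?thesis using main assms by simp
qed

lemma flag_rank_eq:
  assumes "represents_flag n M F" "k \<le> n"
  shows "flag_rank n S F k = submatrix_rank S k M"
  unfolding flag_rank_def
  using assms(1) by (intro submatrix_rank_well_defined[OF _ assms]) (rule someI)

end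

theory Submission
  imports Defs "Jordan_Normal_Form.Matrix_Kernel"
begin

text \<open>
  For \<open>k\<close>-sets \<open>A\<close>, \<open>B\<close> put \<open>g x = card (B \<inter> [1, x)) - card (A \<inter> [1, x))\<close>. Then \<open>A \<le>\<^sub>r B\<close> iff \<open>g\<close> attains
  its maximum over \<open>{1..n}\<close> at \<open>r\<close>. Let \<open>d k\<close> be that maximum for the prefixes \<open>u[k]\<close>, \<open>v[k]\<close>. The distance
  from \<open>u\<close> to \<open>v\<close> in the quantum Bruhat graph is \<open>\<ell> v - \<ell> u + 2 * (\<Sum>k. d k)\<close>: no edge gains more than one,
  and if \<open>i\<close> is the first position where \<open>u\<close> and \<open>v\<close> differ and \<open>u j\<close> is the first later letter of \<open>u\<close> on the
  cyclic arc from \<open>u i\<close> to \<open>v i\<close>, then swapping \<open>i\<close> and \<open>j\<close> is an edge that gains exactly one. As the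
  maxima \<open>d k\<close> are subadditive, \<open>w \<in> [u, v]\<close> iff \<open>u \<le>\<^sub>a w \<le>\<^sub>a v\<close>.

  A flag in the closed variety determines, for each \<open>k\<close>, the minimal and the maximal basis of the matroid of
  \<open>F k\<close> with respect to \<open><\<^bsub>a k\<^esub>\<close>; these will be \<open>x[k]\<close> and \<open>y[k]\<close>. If \<open>g\<close> is maximal at both \<open>a\<close> and \<open>b\<close>,
  the rank conditions force \<open>[a, b)\<close> to be a separator of the matroid, so that passing from \<open>a\<close> to \<open>b\<close>
  changes neither the conditions nor the bases. Hence consecutive bases may be compared with respect to a
  common shift, are nested, and form permutations.
\<close>

section \<open>Inversions and transpositions\<close>

definition inversions :: "nat \<Rightarrow> (nat \<Rightarrow> nat) \<Rightarrow> (nat \<times> nat) set" where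
  "inversions n w = {(a, b). 1 \<le> a \<and> a < b \<and> b \<le> n \<and> w b < w a}"

lemma perm_length_eq_card_inversions: "perm_length n w = card (inversions n w)"
  by (simp add: perm_length_def inversions_def)

lemma finite_inversions: "finite (inversions n w)"
  by (rule finite_subset[of _ "{..n} \<times> {..n}"]) (auto simp: inversions_def)

text \<open>Relabelling positions by the transposition matches the inversions off a small set
  \<open>T\<close>. Inside \<open>T\<close> the old inversions survive; the new ones are
  \<open>(i, j)\<close> and two for each \<open>m\<close> in between whose letter lies between
  \<open>w i\<close> and \<open>w j\<close>.\<close>

lemma perm_length_transpose_less:
  assumes ij: "1 \<le> i" "i < j" "j \<le> n" and less: "w i < w j" and inj: "inj w"
  shows "perm_length n (w \<circ> transpose i j) =
           perm_length n w + 1 + 2 * card {m. i < m \<and> m < j \<and> w i < w m \<and> w m < w j}"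
proof -
  define s where "s = transpose i j"
  \<comment> \<open>The pairs within \<open>[i, j]\<close> that start at \<open>i\<close> or end at
    \<open>j\<close>; off \<open>T\<close> the transposition keeps the two positions in
    order.\<close>
  define T where "T = {(a, b). a < b \<and> ((a = i \<and> b \<le> j) \<or> (i \<le> a \<and> b = j))}"
  define C where "C = {m. i < m \<and> m < j \<and> w i < w m \<and> w m < w j}"
  let ?I = "inversions n w" and ?J = "inversions n (w \<circ> s)"
  have finC: "finite C" by (rule finite_subset[of _ "{..j}"]) (auto simp: C_def)
  have s_range: "1 \<le> s a \<longleftrightarrow> 1 \<le> a" "s a \<le> n \<longleftrightarrow> a \<le> n" for a
    using ij by (auto simp: s_def transpose_def)
  have s_less: "s a < s b \<and> (s a, s b) \<notin> T" if "a < b" "(a, b) \<notin> T" for a b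
    using that ij by (auto simp: s_def transpose_def T_def split: if_splits)
  have ss: "s (s a) = a" for a by (simp add: s_def)
  have "bij_betw (map_prod s s) (?J - T) (?I - T)"
    by (rule bij_betw_byWitness[where f' = "map_prod s s"])
       (use s_range s_less ss in \<open>auto simp: inversions_def\<close>)
  then have off: "card (?J - T) = card (?I - T)" by (rule bij_betw_same_card)
  have ne: "w a \<noteq> w b" if "a \<noteq> b" for a b using inj that by (auto dest: injD)
  have on: "?J \<inter> T = (?I \<inter> T) \<union> ({(i, j)} \<union> (Pair i ` C \<union> (\<lambda>m. (m, j)) ` C))"
  proof (rule Set.set_eqI, unfold split_paired_all)
    fix a b
    consider "a = i" "b = j" | "a = i" "i < b" "b < j" | "b = j" "i < a" "a < j" | "(a, b) \<notin> T"
      by (auto simp: T_def) linarith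
    then show "(a, b) \<in> ?J \<inter> T \<longleftrightarrow>
        (a, b) \<in> (?I \<inter> T) \<union> ({(i, j)} \<union> (Pair i ` C \<union> (\<lambda>m. (m, j)) ` C))"
    proof cases
      case 1
      then show ?thesis using ij less by (auto simp: inversions_def T_def s_def)
    next
      case 2
      then have "(a, b) \<in> ?J \<inter> T \<longleftrightarrow> w b < w j" "(a, b) \<in> ?I \<inter> T \<longleftrightarrow> w b < w i"
        using ij by (auto simp: inversions_def T_def s_def transpose_def)
      then show ?thesis using 2 less ne[of b i] by (auto simp: C_def)
    next
      case 3
      then have "(a, b) \<in> ?J \<inter> T \<longleftrightarrow> w i < w a" "(a, b) \<in> ?I \<inter> T \<longleftrightarrow> w j < w a"
        using ij by (auto simp: inversions_def T_def s_def transpose_def)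
      then show ?thesis using 3 less ne[of a j] by (auto simp: C_def)
    next
      case 4
      then show ?thesis using ij by (auto simp: C_def T_def)
    qed
  qed
  have disj: "(?I \<inter> T) \<inter> ({(i, j)} \<union> (Pair i ` C \<union> (\<lambda>m. (m, j)) ` C)) = {}"
    using less by (auto simp: C_def inversions_def)
  have "card ({(i, j)} \<union> (Pair i ` C \<union> (\<lambda>m. (m, j)) ` C)) = 1 + (card C + card C)"
  proof -
    have "card (Pair i ` C \<union> (\<lambda>m. (m, j)) ` C) = card (Pair i ` C) + card ((\<lambda>m. (m, j)) ` C)"
      using finC by (intro card_Un_disjoint) (auto simp: C_def)
    moreover have "card (Pair i ` C) = card C" "card ((\<lambda>m. (m, j)) ` C) = card C"
      by (auto intro!: card_image inj_onI)
    moreover have "(i, j) \<notin> Pair i ` C \<union> (\<lambda>m. (m, j)) ` C" by (auto simp: C_def)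
    ultimately show ?thesis using finC by simp
  qed
  then have "card (?J \<inter> T) = card (?I \<inter> T) + (1 + 2 * card C)"
    unfolding on using finC finite_inversions disj
    by (subst card_Un_disjoint) auto
  moreover have "card ?J = card (?J - T) + card (?J \<inter> T)" "card ?I = card (?I - T) + card (?I \<inter> T)"
    using card_Int_Diff[OF finite_inversions, of n "w \<circ> s" T] card_Int_Diff[OF finite_inversions, of n w T]
    by simp_all
  ultimately show ?thesis
    using off by (simp add: perm_length_eq_card_inversions C_def s_def)
qed

text \<open>The half-open arc \<open>(p, q]\<close> on the circle; it is only used for \<open>p \<noteq> q\<close>.\<close>

definition in_arc :: "nat \<Rightarrow> nat \<Rightarrow> nat \<Rightarrow> bool" where
  "in_arc p q z = (if p < q then p < z \<and> z \<le> q else p < z \<or> z \<le> q)"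

text \<open>If \<open>w i < w j\<close>, no letter at a position in between has a value in between.
  Otherwise all of them do, and undoing the swap creates \<open>2 * (j - i) - 1\<close> inversions.
  These are the two changes of length allowed on edges.\<close>

lemma perm_length_transpose_arc:
  assumes inj: "inj w" and ij: "1 \<le> i" "i < j" "j \<le> n"
    and arc: "\<And>m. i < m \<Longrightarrow> m < j \<Longrightarrow> \<not> in_arc (w i) (w j) (w m)"
  shows "int (perm_length n (w \<circ> transpose i j)) =
           int (perm_length n w) + 1 - (if w i < w j then 0 else 2 * (int j - int i))"
proof (cases "w i < w j")
  case True
  then have "{m. i < m \<and> m < j \<and> w i < w m \<and> w m < w j} = {}"
    using arc by (force simp: in_arc_def)
  then show ?thesis using perm_length_transpose_less[of i j n w] ij True inj by simp
next
  case False
  let ?w = "w \<circ> transpose i j"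
  have w': "?w \<circ> transpose i j = w" by (simp add: fun_eq_iff)
  have ne: "w i \<noteq> w j" using ij inj by (metis injD less_irrefl)
  have "{m. i < m \<and> m < j \<and> ?w i < ?w m \<and> ?w m < ?w j} = {i<..<j}"
  proof -
    have "w j < w m \<and> w m < w i" if "i < m" "m < j" for m
    proof -
      have "w m \<noteq> w i" using that inj by (metis injD less_irrefl)
      then show ?thesis using arc[OF that] False by (auto simp: in_arc_def)
    qed
    then show ?thesis by (auto simp: transpose_def)
  qed
  moreover have "inj ?w" using inj by (simp add: inj_compose)
  moreover have "?w i < ?w j" using False ne by simp
  ultimately have "perm_length n w = perm_length n ?w + 1 + 2 * (j - Suc i)"
    using perm_length_transpose_less[of i j n ?w] ij unfolding w' by simp
  then show ?thesis using ij False by auto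
qed

section \<open>Prefix counts\<close>

text \<open>The function \<open>g\<close> above. The argument \<open>Suc n\<close> is also used;
  there the value is 0 for subsets of \<open>{1..n}\<close> of equal size.\<close>

definition pref_diff :: "nat set \<Rightarrow> nat set \<Rightarrow> nat \<Rightarrow> int" where
  "pref_diff A B x = int (card (B \<inter> {1..<x})) - int (card (A \<inter> {1..<x}))"

text \<open>For \<open>n = 0\<close> this is the maximum of an empty set, hence the recurring
  assumption \<open>1 \<le> n\<close>.\<close>

definition max_excess :: "nat \<Rightarrow> nat set \<Rightarrow> nat set \<Rightarrow> int" where
  "max_excess n A B = Max (pref_diff A B ` {1..n})"

lemma max_excess_ge: "x \<in> {1..n} \<Longrightarrow> pref_diff A B x \<le> max_excess n A B"
  by (simp add: max_excess_def)

lemma max_excess_attained: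
  assumes "1 \<le> n"
  obtains x where "x \<in> {1..n}" "max_excess n A B = pref_diff A B x"
proof -
  have "max_excess n A B \<in> pref_diff A B ` {1..n}"
    unfolding max_excess_def using assms by (intro Max_in) auto
  then show ?thesis using that by blast
qed

lemma max_excess_eqI:
  "x \<in> {1..n} \<Longrightarrow> pref_diff A B x = m \<Longrightarrow> (\<And>y. y \<in> {1..n} \<Longrightarrow> pref_diff A B y \<le> m) \<Longrightarrow> max_excess n A B = m"
  unfolding max_excess_def by (rule Max_eqI) auto

lemma pref_diff_trans: "pref_diff A C x = pref_diff A B x + pref_diff B C x"
  by (simp add: pref_diff_def)

lemma pref_diff_1 [simp]: "pref_diff A B (Suc 0) = 0"
  by (simp add: pref_diff_def)

lemma pref_diff_last:
  "A \<subseteq> {1..n} \<Longrightarrow> B \<subseteq> {1..n} \<Longrightarrow> card A = card B \<Longrightarrow> pref_diff A B (Suc n) = 0"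
  by (simp add: pref_diff_def Int_absorb2 atLeastLessThanSuc_atLeastAtMost)

lemma max_excess_ge_Suc:
  assumes "A \<subseteq> {1..n}" "B \<subseteq> {1..n}" "card A = card B" "x \<in> {1..Suc n}" "1 \<le> n"
  shows "pref_diff A B x \<le> max_excess n A B"
proof (cases "x = Suc n")
  case True
  then show ?thesis using max_excess_ge[of 1 n A B] pref_diff_last[OF assms(1-3)] assms(5) by simp
next
  case False
  then show ?thesis using assms by (intro max_excess_ge) auto
qed

lemma max_excess_refl: "1 \<le> n \<Longrightarrow> max_excess n A A = 0"
  by (rule max_excess_eqI[of 1]) (auto simp: pref_diff_def)

lemma max_excess_triangle:
  assumes "1 \<le> n"
  shows "max_excess n A C \<le> max_excess n A B + max_excess n B C"
proof -
  obtain x where x: "x \<in> {1..n}" "max_excess n A C = pref_diff A C x"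
    using max_excess_attained[OF assms] .
  then show ?thesis
    using max_excess_ge[OF x(1), of A B] max_excess_ge[OF x(1), of B C] pref_diff_trans[of A C x B] by simp
qed

text \<open>The excess is additive at every point, its maximum only subadditive. Equality therefore
  forces both maxima to be attained where the total excess peaks.\<close>

lemma max_excess_split_iff:
  assumes r: "r \<in> {1..n}" and max: "max_excess n A C = pref_diff A C r"
  shows "max_excess n A B + max_excess n B C = max_excess n A C \<longleftrightarrow>
         max_excess n A B = pref_diff A B r \<and> max_excess n B C = pref_diff B C r"
  using max_excess_ge[OF r, of A B] max_excess_ge[OF r, of B C] max pref_diff_trans[of A C r B] by auto

lemma pref_diff_swap:
  assumes "A \<subseteq> {1..n}" "p \<in> A" "q \<notin> A" "q \<in> {1..n}"
  shows "pref_diff (insert q (A - {p})) B x =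
         pref_diff A B x + (if p < x then 1 else 0) - (if q < x then 1 else 0)"
proof -
  have fin: "finite A" using assms(1) finite_subset by blast
  have p: "1 \<le> p" "p \<noteq> q" using assms by auto
  have "int (card (insert q (A - {p}) \<inter> {1..<x})) =
        int (card (A \<inter> {1..<x})) - (if p < x then 1 else 0) + (if q < x then 1 else 0)"
  proof -
    have 1: "int (card ((A - {p}) \<inter> {1..<x})) = int (card (A \<inter> {1..<x})) - (if p < x then 1 else 0)"
    proof (cases "p < x")
      case True
      then have "p \<in> A \<inter> {1..<x}" using assms p by auto
      moreover have "(A - {p}) \<inter> {1..<x} = (A \<inter> {1..<x}) - {p}" by auto
      ultimately show ?thesis using True fin card_Suc_Diff1[of "A \<inter> {1..<x}" p] by simp
    next
      case False
      then have "(A - {p}) \<inter> {1..<x} = A \<inter> {1..<x}" by auto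
      then show ?thesis using False by simp
    qed
    have 2: "card (insert q (A - {p}) \<inter> {1..<x}) = card ((A - {p}) \<inter> {1..<x}) + (if q < x then 1 else 0)"
      using assms fin by (auto simp: Int_insert_left)
    show ?thesis using 1 2 by simp
  qed
  then show ?thesis by (simp add: pref_diff_def)
qed

section \<open>Counts along cyclic intervals and the shifted orders\<close>

lemma card_cyc_interval:
  assumes "A \<subseteq> {1..n}" "a \<in> {1..n}" "x \<in> {1..n}"
  shows "int (card (A \<inter> cyc_interval n a x)) =
    int (card (A \<inter> {1..<x})) - int (card (A \<inter> {1..<a})) + (if a \<le> x then 0 else int (card A))"
proof -
  have fin: "finite A" using assms(1) finite_subset by blast
  show ?thesis
  proof (cases "a \<le> x")
    case True
    then have "A \<inter> {1..<x} = (A \<inter> {1..<a}) \<union> (A \<inter> {a..<x})" using assms by auto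
    then have "card (A \<inter> {1..<x}) = card (A \<inter> {1..<a}) + card (A \<inter> {a..<x})"
      using fin by (simp add: card_Un_disjoint disjoint_iff)
    then show ?thesis using True by (simp add: cyc_interval_def)
  next
    case False
    have "A = (A \<inter> {1..<a}) \<union> (A \<inter> {a..n})" using assms by auto
    then have "card A = card (A \<inter> {1..<a}) + card (A \<inter> {a..n})"
      using fin by (metis (no_types, lifting) card_Un_disjoint finite_Int disjoint_iff
        IntD2 atLeastAtMost_iff atLeastLessThan_iff not_less)
    moreover have "A \<inter> ({a..n} \<union> {1..<x}) = (A \<inter> {a..n}) \<union> (A \<inter> {1..<x})" by auto
    then have "card (A \<inter> ({a..n} \<union> {1..<x})) = card (A \<inter> {a..n}) + card (A \<inter> {1..<x})"
      using fin False by (simp add: card_Un_disjoint disjoint_iff)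
    ultimately show ?thesis using False by (simp add: cyc_interval_def)
  qed
qed

text \<open>A wrapping interval contributes the whole cardinality, which cancels for sets of equal
  size. Comparing counts along intervals from \<open>a\<close> is thus comparing \<open>g\<close> at
  \<open>x\<close> with \<open>g\<close> at \<open>a\<close>.\<close>

lemma pref_diff_cyc_interval:
  assumes "A \<subseteq> {1..n}" "B \<subseteq> {1..n}" "card A = card B" "a \<in> {1..n}" "x \<in> {1..n}"
  shows "int (card (B \<inter> cyc_interval n a x)) - int (card (A \<inter> cyc_interval n a x)) =
    pref_diff A B x - pref_diff A B a"
  using card_cyc_interval[OF assms(1,4,5)] card_cyc_interval[OF assms(2,4,5)] assms(3)
  by (simp add: pref_diff_def)

text \<open>Converse of \<open>sorted_list_le_of_counts\<close>: an index whose entry from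
  \<open>Y\<close> is below \<open>t\<close> has its entry from \<open>X\<close> below
  \<open>t\<close> too.\<close>

lemma counts_of_sorted_list_le:
  fixes X Y :: "nat set"
  assumes "finite X" "finite Y"
    and le: "list_all2 (\<le>) (sorted_list_of_set X) (sorted_list_of_set Y)"
  shows "card (Y \<inter> {..<t}) \<le> card (X \<inter> {..<t})"
proof -
  define xs where "xs = sorted_list_of_set X"
  define ys where "ys = sorted_list_of_set Y"
  have X: "set xs = X" "distinct xs" and Y: "set ys = Y" "distinct ys"
    using assms(1,2) by (auto simp: xs_def ys_def)
  have len: "length xs = length ys" and nth: "\<And>j. j < length ys \<Longrightarrow> xs ! j \<le> ys ! j"
    using le by (auto simp: xs_def ys_def list_all2_conv_all_nth)
  define J where "J = {j. j < length ys \<and> ys ! j < t}"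
  have "Y \<inter> {..<t} = (!) ys ` J"
    using Y(1) by (auto simp: J_def in_set_conv_nth)
  then have "card (Y \<inter> {..<t}) \<le> card J" by (simp add: card_image_le J_def)
  also have "\<dots> = card ((!) xs ` J)"
    by (rule card_image[symmetric]) (use X len in \<open>auto simp: inj_on_def J_def nth_eq_iff_index_eq\<close>)
  also have "\<dots> \<le> card (X \<inter> {..<t})"
  proof (rule card_mono)
    show "(!) xs ` J \<subseteq> X \<inter> {..<t}"
      using X len nth by (force simp: J_def)
  qed (use assms in auto)
  finally show ?thesis .
qed

lemma cyc_interval_eq_cyc_pos:
  assumes "a \<in> {1..n}" "x \<in> {1..n}"
  shows "cyc_interval n a x = {z \<in> {1..n}. cyc_pos n a z < cyc_pos n a x}"
  using assms by (auto simp: cyc_interval_def cyc_pos_def)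

lemma max_excess_iff_cyc:
  assumes "A \<subseteq> {1..n}" "B \<subseteq> {1..n}" "card A = card B" and a: "a \<in> {1..n}"
  shows "max_excess n A B = pref_diff A B a \<longleftrightarrow>
    (\<forall>x\<in>{1..n}. card (B \<inter> cyc_interval n a x) \<le> card (A \<inter> cyc_interval n a x))"
proof -
  have "(\<forall>x\<in>{1..n}. card (B \<inter> cyc_interval n a x) \<le> card (A \<inter> cyc_interval n a x)) \<longleftrightarrow>
        (\<forall>x\<in>{1..n}. pref_diff A B x \<le> pref_diff A B a)"
    using pref_diff_cyc_interval[OF assms] by force
  also have "\<dots> \<longleftrightarrow> max_excess n A B = pref_diff A B a"
    using a max_excess_ge[of _ n A B] by (auto intro: max_excess_eqI)
  finally show ?thesis by simp
qed

text \<open>\<open>cyc_pos n r\<close> turns \<open><\<^sub>r\<close> into the usual order, where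
  comparing sorted lists means comparing counts in initial segments. Proper initial segments are the
  cyclic intervals starting at \<open>r\<close>.\<close>

lemma subset_le_iff:
  assumes r: "r \<in> {1..n}" and A: "A \<subseteq> {1..n}" and B: "B \<subseteq> {1..n}" and c: "card A = card B"
  shows "subset_le n r A B \<longleftrightarrow> max_excess n A B = pref_diff A B r"
proof -
  let ?p = "cyc_pos n r"
  have fin: "finite A" "finite B" using A B finite_subset by blast+
  have cnt: "card (?p ` Z \<inter> {..<?p x}) = card (Z \<inter> cyc_interval n r x)"
    if "Z \<subseteq> {1..n}" "x \<in> {1..n}" for Z x
  proof -
    have "?p ` Z \<inter> {..<?p x} = ?p ` (Z \<inter> cyc_interval n r x)"
      using that cyc_interval_eq_cyc_pos[OF r that(2)] by auto
    then show ?thesis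
      using card_image[OF inj_on_subset[OF cyc_pos_inj[OF r], of "Z \<inter> cyc_interval n r x"]] that
      by auto
  qed
  have card: "card (?p ` Z) = card Z" if "Z \<subseteq> {1..n}" for Z
    using that by (intro card_image inj_on_subset[OF cyc_pos_inj[OF r]])
  have lt: "?p z < n" if "z \<in> {1..n}" for z using that r by (auto simp: cyc_pos_def)
  have surj: "\<exists>x\<in>{1..n}. ?p x = t" if "t < n" for t
    by (rule bexI[of _ "if r + t \<le> n then r + t else r + t - n"]) (use that r in \<open>auto simp: cyc_pos_def\<close>)
  have "subset_le n r A B \<longleftrightarrow> list_all2 (\<le>) (sorted_list_of_set (?p ` A)) (sorted_list_of_set (?p ` B))"
    unfolding map_cyc_pos_sorted[OF r A, symmetric] map_cyc_pos_sorted[OF r B, symmetric]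
    by (simp add: subset_le_def list_all2_map1 list_all2_map2)
  also have "\<dots> \<longleftrightarrow> (\<forall>t. card (?p ` B \<inter> {..<t}) \<le> card (?p ` A \<inter> {..<t}))"
    using fin card[OF A] card[OF B] c counts_of_sorted_list_le[of "?p ` A" "?p ` B"]
      sorted_list_le_of_counts[of "?p ` A" "?p ` B"] by fastforce
  also have "\<dots> \<longleftrightarrow> (\<forall>x\<in>{1..n}. card (B \<inter> cyc_interval n r x) \<le> card (A \<inter> cyc_interval n r x))"
  proof safe
    fix x assume "\<forall>t. card (?p ` B \<inter> {..<t}) \<le> card (?p ` A \<inter> {..<t})" "x \<in> {1..n}"
    then show "card (B \<inter> cyc_interval n r x) \<le> card (A \<inter> cyc_interval n r x)"
      using cnt[OF A] cnt[OF B] by metis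
  next
    fix t assume *: "\<forall>x\<in>{1..n}. card (B \<inter> cyc_interval n r x) \<le> card (A \<inter> cyc_interval n r x)"
    show "card (?p ` B \<inter> {..<t}) \<le> card (?p ` A \<inter> {..<t})"
    proof (cases "t < n")
      case True
      then show ?thesis using surj cnt[OF A] cnt[OF B] * by metis
    next
      case False
      then have "?p ` A \<inter> {..<t} = ?p ` A" "?p ` B \<inter> {..<t} = ?p ` B"
        using lt A B by (force simp: image_iff)+
      then show ?thesis using card[OF A] card[OF B] c by simp
    qed
  qed
  also have "\<dots> \<longleftrightarrow> max_excess n A B = pref_diff A B r"
    by (rule max_excess_iff_cyc[OF A B c r, symmetric])
  finally show ?thesis .
qed

section \<open>Distances in the quantum Bruhat graph\<close>

text \<open>The claimed distance formula, kept as an integer because its sign is not evident before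
  it is known to be a distance.\<close>

definition qb_weight :: "nat \<Rightarrow> (nat \<Rightarrow> nat) \<Rightarrow> (nat \<Rightarrow> nat) \<Rightarrow> int" where
  "qb_weight n u v = int (perm_length n v) - int (perm_length n u) +
     2 * (\<Sum>k\<in>{1..n}. max_excess n (u ` {1..k}) (v ` {1..k}))"

lemma qb_weight_refl: "qb_weight n u u = 0"
  by (auto simp: qb_weight_def max_excess_refl)

lemma qb_weight_triangle: "qb_weight n u w \<le> qb_weight n u v + qb_weight n v w"
proof -
  have "(\<Sum>k\<in>{1..n}. max_excess n (u ` {1..k}) (w ` {1..k})) \<le>
    (\<Sum>k\<in>{1..n}. max_excess n (u ` {1..k}) (v ` {1..k}) + max_excess n (v ` {1..k}) (w ` {1..k}))"
    by (intro sum_mono max_excess_triangle) auto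
  then show ?thesis by (simp add: qb_weight_def sum.distrib)
qed

section \<open>Prefixes under a swap and the lower bound on path lengths\<close>

lemma prefix_subset:
  fixes w :: "nat \<Rightarrow> nat"
  assumes w: "w permutes {1..n}" and k: "k \<le> n"
  shows "w ` {1..k} \<subseteq> {1..n}"
proof -
  have "{1..k} \<subseteq> {1..n}" using k by simp
  then have "w ` {1..k} \<subseteq> w ` {1..n}" by (rule image_mono)
  then show ?thesis unfolding permutes_image[OF w] .
qed

lemma prefix_card:
  fixes w :: "nat \<Rightarrow> nat"
  assumes "w permutes {1..n}"
  shows "card (w ` {1..k}) = k"
  using permutes_inj_on[OF assms, of "{1..k}"] by (simp add: card_image)

lemma prefix_transpose_inside:
  fixes w :: "nat \<Rightarrow> nat"
  assumes "inj w" "1 \<le> i" "i \<le> k" "k < j"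
  shows "(w \<circ> transpose i j) ` {1..k} = insert (w j) (w ` {1..k} - {w i})"
proof -
  have "transpose i j ` {1..k} = insert j ({1..k} - {i})"
    using assms by (auto simp: transpose_def image_iff)
  then show ?thesis
    using assms(1) unfolding image_comp[symmetric] by (simp add: image_set_diff)
qed

lemma prefix_transpose_outside:
  fixes w :: "nat \<Rightarrow> nat"
  assumes "i < j" "1 \<le> i" "k < i \<or> j \<le> k"
  shows "(w \<circ> transpose i j) ` {1..k} = w ` {1..k}"
proof -
  have "transpose i j ` {1..k} = {1..k}"
    using assms by (auto simp: transpose_def image_iff)
  then show ?thesis unfolding image_comp[symmetric] by simp
qed

lemma sum_inside_indicator:
  assumes "1 \<le> i" "i < j" "j \<le> n"
  shows "(\<Sum>k\<in>{1..n}. if i \<le> k \<and> k < j then 1 else (0::int)) = int j - int i"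
proof -
  have "(\<Sum>k\<in>{1..n}. if i \<le> k \<and> k < j then 1 else (0::int)) = (\<Sum>k\<in>{i..<j}. 1)"
    using assms by (intro sum.mono_neutral_cong_right) auto
  then show ?thesis using assms by simp
qed

text \<open>For \<open>i \<le> k < j\<close> the prefix trades \<open>w i\<close> for
  \<open>w j\<close>, so its excess at \<open>x\<close> is positive only if
  \<open>w j < x \<le> w i\<close>, and is then 1. All other prefixes are unchanged.\<close>

lemma max_excess_transpose_le:
  assumes w: "w permutes {1..n}" and ij: "1 \<le> i" "i < j" "j \<le> n" and k: "k \<in> {1..n}"
  shows "max_excess n (w ` {1..k}) ((w \<circ> transpose i j) ` {1..k}) \<le>
           (if w j < w i \<and> i \<le> k \<and> k < j then 1 else 0)"
proof (cases "i \<le> k \<and> k < j")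
  case True
  let ?A = "w ` {1..k}"
  let ?A' = "insert (w j) (?A - {w i})"
  have inj: "inj w" by (rule permutes_inj[OF w])
  have mem: "w i \<in> ?A" "w j \<notin> ?A" "w j \<in> {1..n}"
    using True ij permutes_in_image[OF w, of j] by (auto simp: inj_image_mem_iff[OF inj])
  obtain x where x: "max_excess n ?A ?A' = pref_diff ?A ?A' x"
    using max_excess_attained[of n ?A ?A'] k by auto
  have "pref_diff ?A ?A' x = - pref_diff ?A' ?A x" by (simp add: pref_diff_def)
  also have "\<dots> = (if w j < x then 1 else 0) - (if w i < x then 1 else 0)"
    using pref_diff_swap[OF prefix_subset[OF w] mem, of ?A x] k by (simp add: pref_diff_def)
  finally show ?thesis
    unfolding prefix_transpose_inside[OF inj ij(1) conjunct1[OF True] conjunct2[OF True]] x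
    using True by auto
next
  case False
  then have "(w \<circ> transpose i j) ` {1..k} = w ` {1..k}"
    using ij by (intro prefix_transpose_outside) auto
  then show ?thesis using False k by (auto simp: max_excess_refl)
qed

text \<open>A descending edge loses \<open>2 * (j - i) - 1\<close> inversions, while the
  \<open>j - i\<close> affected prefixes have excess at most 1 and count twice. An ascending edge
  has no excess.\<close>

lemma quantum_bruhat_edge_weight:
  assumes "(w, w') \<in> quantum_bruhat_graph n"
  shows "w permutes {1..n}" "w' permutes {1..n}" "qb_weight n w w' \<le> 1"
proof -
  obtain i j where w: "w permutes {1..n}" and w': "w' = w \<circ> transpose i j" and ij: "1 \<le> i" "i < j" "j \<le> n"
    and len: "int (perm_length n w') = int (perm_length n w) + 1 \<or>
         int (perm_length n w') = int (perm_length n w) + 1 - 2 * (int j - int i)"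
    using assms by (auto simp: quantum_bruhat_graph_def)
  show "w permutes {1..n}" by (rule w)
  show "w' permutes {1..n}" unfolding w'
    by (rule permutes_compose[OF permutes_swap_id w]) (use ij in auto)
  have le: "(\<Sum>k\<in>{1..n}. max_excess n (w ` {1..k}) (w' ` {1..k})) \<le>
        (\<Sum>k\<in>{1..n}. if w j < w i \<and> i \<le> k \<and> k < j then 1 else (0::int))"
    unfolding w' by (intro sum_mono max_excess_transpose_le[OF w ij])
  show "qb_weight n w w' \<le> 1"
  proof (cases "w j < w i")
    case True
    have "w' \<circ> transpose i j = w" by (simp add: w' fun_eq_iff)
    then have "perm_length n w' < perm_length n w"
      using perm_length_transpose_less[of i j n w'] ij True permutes_inj[OF w]
      by (simp add: w' inj_compose)
    then have "int (perm_length n w') = int (perm_length n w) + 1 - 2 * (int j - int i)"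
      using len by simp
    then show ?thesis using le sum_inside_indicator[OF ij] True by (simp add: qb_weight_def)
  next
    case False
    then have "(\<Sum>k\<in>{1..n}. max_excess n (w ` {1..k}) (w' ` {1..k})) \<le> 0" using le by simp
    then show ?thesis using len ij by (auto simp: qb_weight_def)
  qed
qed

lemma qb_weight_le_path_length:
  assumes "(u, v) \<in> quantum_bruhat_graph n ^^ d"
  shows "qb_weight n u v \<le> int d"
  using assms
proof (induction d arbitrary: v)
  case 0
  then show ?case by (simp add: qb_weight_refl)
next
  case (Suc d)
  then obtain w where "(u, w) \<in> quantum_bruhat_graph n ^^ d" "(w, v) \<in> quantum_bruhat_graph n"
    by auto
  then show ?case
    using Suc.IH[of w] quantum_bruhat_edge_weight(3)[of w v n] qb_weight_triangle[of n u v w] by simp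
qed

section \<open>Shortest paths: the step at the first difference\<close>

lemma pref_diff_arc:
  assumes "A \<subseteq> {1..n}" "B \<subseteq> {1..n}" "card A = card B" "1 \<le> x" "y \<le> n"
  defines "C \<equiv> (if x \<le> y then {x..y} else {x..n} \<union> {1..y})"
  shows "pref_diff A B (Suc y) - pref_diff A B x = int (card (B \<inter> C)) - int (card (A \<inter> C))"
proof -
  \<comment> \<open>A wrapping arc has a surplus of \<open>card Z\<close>, the same for
    \<open>A\<close> and \<open>B\<close>.\<close>
  have "int (card (Z \<inter> {1..<Suc y})) - int (card (Z \<inter> {1..<x})) =
        int (card (Z \<inter> C)) - (if x \<le> y then 0 else int (card Z))" if Z: "Z \<subseteq> {1..n}" for Z
  proof (cases "x \<le> y")
    case True
    then have "Z \<inter> {1..<Suc y} = (Z \<inter> {1..<x}) \<union> (Z \<inter> C)" using assms by auto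
    moreover have "(Z \<inter> {1..<x}) \<inter> (Z \<inter> C) = {}" using True by (auto simp: C_def)
    ultimately have "card (Z \<inter> {1..<Suc y}) = card (Z \<inter> {1..<x}) + card (Z \<inter> C)"
      using True by (simp add: card_Un_disjoint C_def)
    then show ?thesis using True by simp
  next
    case False
    have fin: "finite Z" using Z finite_subset by blast
    have cZ: "card Z = card (Z \<inter> {1..<x}) + card (Z \<inter> {x..n})"
    proof -
      have "Z = (Z \<inter> {1..<x}) \<union> (Z \<inter> {x..n})" using Z by auto
      moreover have "(Z \<inter> {1..<x}) \<inter> (Z \<inter> {x..n}) = {}" by auto
      ultimately show ?thesis
        using card_Un_disjoint[of "Z \<inter> {1..<x}" "Z \<inter> {x..n}"] fin by (metis finite_Int)
    qed
    have "Z \<inter> C = (Z \<inter> {1..<Suc y}) \<union> (Z \<inter> {x..n})" using False by (auto simp: C_def)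
    moreover have "(Z \<inter> {1..<Suc y}) \<inter> (Z \<inter> {x..n}) = {}" using False by auto
    ultimately have "card (Z \<inter> C) = card (Z \<inter> {1..<Suc y}) + card (Z \<inter> {x..n})"
      using card_Un_disjoint[of "Z \<inter> {1..<Suc y}" "Z \<inter> {x..n}"] fin by (metis finite_Int)
    then show ?thesis using cZ False by simp
  qed
  from this[OF assms(1)] this[OF assms(2)] assms(3) show ?thesis
    by (auto simp: pref_diff_def split: if_splits)
qed

lemma in_arc_trans:
  assumes "p \<noteq> q" "in_arc p q r" "in_arc p r z"
  shows "in_arc p q z"
  using assms by (auto simp: in_arc_def split: if_splits)

text \<open>If \<open>u\<close> and \<open>v\<close> first differ at \<open>i\<close>, and \<open>u j\<close> is the first later letter of \<open>u\<close> on the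
  arc from \<open>u i\<close> to \<open>v i\<close>, then on \<open>(u i, u j]\<close> the excess is not yet maximal: moving on to
  \<open>v i + 1\<close> gains the letter \<open>v i\<close> and loses nothing.\<close>

lemma excess_less_max:
  assumes u: "u permutes {1..n}" and v: "v permutes {1..n}"
    and i: "1 \<le> i" "\<And>m. 1 \<le> m \<Longrightarrow> m < i \<Longrightarrow> u m = v m" "u i \<noteq> v i"
    and j: "j \<le> n" "in_arc (u i) (v i) (u j)" "\<And>m. i < m \<Longrightarrow> m < j \<Longrightarrow> \<not> in_arc (u i) (v i) (u m)"
    and k: "i \<le> k" "k < j" and x: "x \<in> {1..n}" "in_arc (u i) (u j) x"
  shows "pref_diff (u ` {1..k}) (v ` {1..k}) x < max_excess n (u ` {1..k}) (v ` {1..k})"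
proof -
  let ?A = "u ` {1..k}" and ?B = "v ` {1..k}"
  define C where "C = (if x \<le> v i then {x..v i} else {x..n} \<union> {1..v i})"
  have kn: "k \<le> n" using k j by simp
  have A: "?A \<subseteq> {1..n}" and B: "?B \<subseteq> {1..n}" using prefix_subset[OF u kn] prefix_subset[OF v kn] by auto
  have c: "card ?A = card ?B" using prefix_card[OF u] prefix_card[OF v] by simp
  have vi: "v i \<in> {1..n}" using permutes_in_image[OF v, of i] i(1) k kn by auto
  have C_arc: "in_arc (u i) (v i) z" if "z \<in> C" for z
    using that x(2) j(2) i(3) by (auto simp: C_def in_arc_def split: if_splits)
  have viC: "v i \<in> C" using vi by (auto simp: C_def)
  \<comment> \<open>Letters of \<open>u\<close> at positions \<open>i\<close> to \<open>k\<close>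
    avoid the arc, so those on \<open>C\<close> come from the prefix shared with
    \<open>v\<close>.\<close>
  have AC: "?A \<inter> C \<subseteq> v ` {1..<i}"
  proof
    fix z assume "z \<in> ?A \<inter> C"
    then obtain m where m: "m \<in> {1..k}" "z = u m" and zC: "z \<in> C" by auto
    have "\<not> in_arc (u i) (v i) (u i)" using i(3) by (auto simp: in_arc_def)
    then have "m < i" using C_arc[OF zC] m j(3)[of m] k by (metis atLeastAtMost_iff le_less_trans linorder_neqE_nat)
    then show "z \<in> v ` {1..<i}" using m i(2)[of m] by auto
  qed
  have "v i \<notin> v ` {1..<i}" by (simp add: inj_image_mem_iff[OF permutes_inj[OF v]])
  then have "v i \<notin> ?A \<inter> C" using AC by blast
  then have "Suc (card (?A \<inter> C)) = card (insert (v i) (?A \<inter> C))" by simp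
  also have "\<dots> \<le> card (?B \<inter> C)"
  proof (rule card_mono)
    have "v ` {1..<i} \<subseteq> ?B" using k by (intro image_mono) auto
    then show "insert (v i) (?A \<inter> C) \<subseteq> ?B \<inter> C" using AC viC k i(1) by auto
  qed simp
  finally have "pref_diff ?A ?B x < pref_diff ?A ?B (Suc (v i))"
    using pref_diff_arc[OF A B c, of x "v i"] x(1) vi unfolding C_def by auto
  also have "\<dots> \<le> max_excess n ?A ?B"
    using vi x(1) by (intro max_excess_ge_Suc[OF A B c]) auto
  finally show ?thesis .
qed

text \<open>Up to a constant shift, the exchange raises the excess by one on the arc
  \<open>(p, q]\<close> and nowhere else. As the excess was below its maximum there, no higher peak
  appears.\<close>

lemma gap_swap:
  assumes A: "A \<subseteq> {1..n}" and p: "p \<in> A" and q: "q \<notin> A" "q \<in> {1..n}" and n: "1 \<le> n"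
    and below: "\<And>x. x \<in> {1..n} \<Longrightarrow> in_arc p q x \<Longrightarrow> pref_diff A B x < max_excess n A B"
  defines "A' \<equiv> insert q (A - {p})"
  shows "max_excess n A' B = max_excess n A B - (if q < p then 1 else 0)"
    "max_excess n A' B - pref_diff A' B x =
       max_excess n A B - pref_diff A B x - (if in_arc p q x then 1 else 0)"
proof -
  \<comment> \<open>The two indicators \<open>p < x\<close> and \<open>q < x\<close> differ by the
    indicator of the arc, less one when the arc wraps.\<close>
  have pd: "pref_diff A' B x = pref_diff A B x - (if q < p then 1 else 0) + (if in_arc p q x then 1 else 0)" for x
    unfolding A'_def pref_diff_swap[OF A p q] using p q by (auto simp: in_arc_def)
  obtain x0 where x0: "x0 \<in> {1..n}" "max_excess n A B = pref_diff A B x0"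
    using max_excess_attained[OF n] .
  then have "\<not> in_arc p q x0" using below[of x0] by auto
  then show 1: "max_excess n A' B = max_excess n A B - (if q < p then 1 else 0)"
  proof (intro max_excess_eqI[OF x0(1)])
    show "pref_diff A' B x0 = max_excess n A B - (if q < p then 1 else 0)"
      using pd[of x0] x0(2) \<open>\<not> in_arc p q x0\<close> by simp
    show "pref_diff A' B y \<le> max_excess n A B - (if q < p then 1 else 0)" if "y \<in> {1..n}" for y
      using pd[of y] below[OF that] max_excess_ge[OF that, of A B] by (auto split: if_splits)
  qed
  show "max_excess n A' B - pref_diff A' B x =
       max_excess n A B - pref_diff A B x - (if in_arc p q x then 1 else 0)"
    using 1 pd[of x] by simp
qed

text \<open>Termination measure for building a path: a sum of evidently nonnegative terms.\<close>

definition total_gap :: "nat \<Rightarrow> (nat \<Rightarrow> nat) \<Rightarrow> (nat \<Rightarrow> nat) \<Rightarrow> int" where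
  "total_gap n u v = (\<Sum>k\<in>{1..n}. \<Sum>x\<in>{1..n}.
     max_excess n (u ` {1..k}) (v ` {1..k}) - pref_diff (u ` {1..k}) (v ` {1..k}) x)"

lemma total_gap_nonneg: "0 \<le> total_gap n u v"
  unfolding total_gap_def by (intro sum_nonneg) (auto simp: max_excess_ge)

text \<open>The letter \<open>v i\<close> itself lies on the arc and occurs in \<open>u\<close>
  after position \<open>i\<close>, since the earlier letters agree with those of \<open>v\<close>.
  So a first such position \<open>j\<close> exists.\<close>

lemma first_difference:
  assumes u: "u permutes {1..n}" and v: "v permutes {1..n}" and ne: "u \<noteq> v"
  obtains i j where "1 \<le> i" "i < j" "j \<le> n" "\<And>m. 1 \<le> m \<Longrightarrow> m < i \<Longrightarrow> u m = v m" "u i \<noteq> v i"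
    "in_arc (u i) (v i) (u j)" "\<And>m. i < m \<Longrightarrow> m < j \<Longrightarrow> \<not> in_arc (u i) (v i) (u m)"
proof -
  define i where "i = (LEAST i. u i \<noteq> v i)"
  have "\<exists>i. u i \<noteq> v i" using ne by blast
  then have i: "u i \<noteq> v i" unfolding i_def by (rule LeastI_ex)
  have least_i: "u m = v m" if "m < i" for m
    using not_less_Least[of m "\<lambda>i. u i \<noteq> v i"] that by (simp add: i_def)
  have i_in: "i \<in> {1..n}"
    using i permutes_not_in[OF u, of i] permutes_not_in[OF v, of i] by metis
  then have vi: "v i \<in> {1..n}" using permutes_in_image[OF v] by simp
  then obtain m where m: "m \<in> {1..n}" "u m = v i" using permutes_image[OF u] by (metis imageE)
  have "m \<noteq> i" using m i by auto
  moreover have "\<not> m < i" using least_i[of m] m i injD[OF permutes_inj[OF v], of m i] by auto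
  ultimately have "i < m" by simp
  then have ex: "\<exists>j. i < j \<and> in_arc (u i) (v i) (u j)"
    using m i by (intro exI[of _ m]) (auto simp: in_arc_def)
  define j where "j = (LEAST j. i < j \<and> in_arc (u i) (v i) (u j))"
  have j: "i < j \<and> in_arc (u i) (v i) (u j)" unfolding j_def by (rule LeastI_ex[OF ex])
  have "j \<le> m" unfolding j_def using \<open>i < m\<close> m i by (intro Least_le) (auto simp: in_arc_def)
  moreover have "\<not> in_arc (u i) (v i) (u l)" if "i < l" "l < j" for l
    using not_less_Least[of l "\<lambda>j. i < j \<and> in_arc (u i) (v i) (u j)"] that by (auto simp: j_def)
  ultimately show ?thesis using that[of i j] i i_in least_i j m by auto
qed

text \<open>The arc \<open>(u i, u j]\<close> is part of \<open>(u i, v i]\<close>, hence avoided by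
  the positions between \<open>i\<close> and \<open>j\<close>, and the swap is an edge. If it
  descends, each of the \<open>j - i\<close> maxima drops by one, which compensates the loss of
  length up to exactly one.\<close>

lemma qb_step:
  assumes u: "u permutes {1..n}" and v: "v permutes {1..n}" and ne: "u \<noteq> v"
  obtains u' where "(u, u') \<in> quantum_bruhat_graph n"
    "qb_weight n u' v = qb_weight n u v - 1" "total_gap n u' v < total_gap n u v"
proof -
  obtain i j where i: "1 \<le> i" and ij: "i < j" "j \<le> n" and eq: "\<And>m. 1 \<le> m \<Longrightarrow> m < i \<Longrightarrow> u m = v m"
    and nei: "u i \<noteq> v i" and arc: "in_arc (u i) (v i) (u j)"
    and free: "\<And>m. i < m \<Longrightarrow> m < j \<Longrightarrow> \<not> in_arc (u i) (v i) (u m)"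
    using first_difference[OF u v ne] by metis
  define u' where "u' = u \<circ> transpose i j"
  have inj: "inj u" by (rule permutes_inj[OF u])
  have len: "int (perm_length n u') =
      int (perm_length n u) + 1 - (if u i < u j then 0 else 2 * (int j - int i))"
    unfolding u'_def using free in_arc_trans[OF nei arc]
    by (intro perm_length_transpose_arc[OF inj i ij]) blast
  then have edge: "(u, u') \<in> quantum_bruhat_graph n"
    using u i ij unfolding quantum_bruhat_graph_def u'_def by (force split: if_splits)
  have uj: "u j \<in> {1..n}" using permutes_in_image[OF u, of j] i ij by simp
  have ne_ij: "u i \<noteq> u j" using inj ij by (metis injD less_irrefl)
  let ?M = "\<lambda>w k. max_excess n (w ` {1..k}) (v ` {1..k})"
  let ?P = "\<lambda>w k. pref_diff (w ` {1..k}) (v ` {1..k})"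
  have out: "u' ` {1..k} = u ` {1..k}" if "\<not> (i \<le> k \<and> k < j)" for k
    unfolding u'_def using that i ij by (intro prefix_transpose_outside) auto
  have inside: "?M u' k = ?M u k - (if u j < u i then 1 else 0)"
    "?M u' k - ?P u' k x = ?M u k - ?P u k x - (if in_arc (u i) (u j) x then 1 else 0)"
    if k: "i \<le> k" "k < j" for k x
  proof -
    have eq': "u' ` {1..k} = insert (u j) (u ` {1..k} - {u i})"
      unfolding u'_def by (rule prefix_transpose_inside[OF inj i k])
    have kn: "k \<le> n" "1 \<le> n" using k ij i by auto
    have mem: "u i \<in> u ` {1..k}" "u j \<notin> u ` {1..k}" using k i by (auto simp: inj_image_mem_iff[OF inj])
    have below: "?P u k x < ?M u k" if "x \<in> {1..n}" "in_arc (u i) (u j) x" for x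
      by (rule excess_less_max[OF u v i eq nei ij(2) arc free k that])
    show "?M u' k = ?M u k - (if u j < u i then 1 else 0)"
      unfolding eq' by (rule gap_swap[OF prefix_subset[OF u kn(1)] mem uj kn(2) below])
    show "?M u' k - ?P u' k x = ?M u k - ?P u k x - (if in_arc (u i) (u j) x then 1 else 0)"
      unfolding eq' by (rule gap_swap[OF prefix_subset[OF u kn(1)] mem uj kn(2) below])
  qed
  have "(\<Sum>k\<in>{1..n}. ?M u' k) =
      (\<Sum>k\<in>{1..n}. ?M u k - (if u j < u i then 1 else 0) * (if i \<le> k \<and> k < j then 1 else 0))"
    using out inside(1) by (intro sum.cong refl) auto
  also have "\<dots> = (\<Sum>k\<in>{1..n}. ?M u k) - (if u j < u i then 1 else 0) * (int j - int i)"
    by (simp only: sum_subtractf sum_distrib_left[symmetric] sum_inside_indicator[OF i ij])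
  finally have "qb_weight n u' v = qb_weight n u v - 1"
    using len ne_ij by (auto simp: qb_weight_def)
  moreover have "total_gap n u' v < total_gap n u v"
    unfolding total_gap_def
  proof (rule sum_strict_mono_ex1)
    show "\<forall>k\<in>{1..n}. (\<Sum>x\<in>{1..n}. ?M u' k - ?P u' k x) \<le> (\<Sum>x\<in>{1..n}. ?M u k - ?P u k x)"
    proof
      fix k assume "k \<in> {1..n}"
      show "(\<Sum>x\<in>{1..n}. ?M u' k - ?P u' k x) \<le> (\<Sum>x\<in>{1..n}. ?M u k - ?P u k x)"
      proof (cases "i \<le> k \<and> k < j")
        case True
        then have "?M u' k - ?P u' k x \<le> ?M u k - ?P u k x" for x using inside(2)[of k x] by simp
        then show ?thesis by (intro sum_mono)
      next
        case False
        show ?thesis unfolding out[OF False] by simp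
      qed
    qed
    \<comment> \<open>The measure drops strictly at \<open>k = i\<close>, \<open>x = u j\<close>, as
      \<open>u j\<close> is on its own arc.\<close>
    have "(\<Sum>x\<in>{1..n}. ?M u' i - ?P u' i x) < (\<Sum>x\<in>{1..n}. ?M u i - ?P u i x)"
    proof (rule sum_strict_mono_ex1)
      show "\<forall>x\<in>{1..n}. ?M u' i - ?P u' i x \<le> ?M u i - ?P u i x"
        using inside(2)[of i] ij by auto
      show "\<exists>x\<in>{1..n}. ?M u' i - ?P u' i x < ?M u i - ?P u i x"
        using inside(2)[of i "u j"] ij uj ne_ij by (intro bexI[of _ "u j"]) (auto simp: in_arc_def)
    qed simp
    then show "\<exists>k\<in>{1..n}. (\<Sum>x\<in>{1..n}. ?M u' k - ?P u' k x) < (\<Sum>x\<in>{1..n}. ?M u k - ?P u k x)"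
      using i ij by (intro bexI[of _ i]) auto
  qed simp
  ultimately show ?thesis using that edge by blast
qed

lemma qb_path_exists:
  assumes "u permutes {1..n}" and v: "v permutes {1..n}"
  shows "\<exists>d. (u, v) \<in> quantum_bruhat_graph n ^^ d \<and> int d = qb_weight n u v"
  using assms(1)
proof (induction "nat (total_gap n u v)" arbitrary: u rule: less_induct)
  case less
  show ?case
  proof (cases "u = v")
    case True
    then show ?thesis by (intro exI[of _ 0]) (simp add: qb_weight_refl)
  next
    case False
    obtain u' where u': "(u, u') \<in> quantum_bruhat_graph n"
      "qb_weight n u' v = qb_weight n u v - 1" "total_gap n u' v < total_gap n u v"
      using qb_step[OF less.prems v False] .
    have "nat (total_gap n u' v) < nat (total_gap n u v)"
      using u'(3) total_gap_nonneg[of n u' v] by simp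
    then obtain d where "(u', v) \<in> quantum_bruhat_graph n ^^ d" "int d = qb_weight n u' v"
      using less.hyps quantum_bruhat_edge_weight(2)[OF u'(1)] by blast
    then show ?thesis using u' by (intro exI[of _ "Suc d"] conjI relpow_Suc_I2) auto
  qed
qed

lemma qb_dist_eq_weight:
  assumes "u permutes {1..n}" "v permutes {1..n}"
  shows "int (qb_dist n u v) = qb_weight n u v"
proof -
  obtain d where d: "(u, v) \<in> quantum_bruhat_graph n ^^ d" "int d = qb_weight n u v"
    using qb_path_exists[OF assms] by blast
  have "qb_dist n u v = d" unfolding qb_dist_def
  proof (rule Least_equality)
    show "d \<le> d'" if "(u, v) \<in> quantum_bruhat_graph n ^^ d'" for d'
      using qb_weight_le_path_length[OF that] d(2) by simp
  qed (rule d)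
  then show ?thesis using d by simp
qed

section \<open>Tilted intervals in terms of shifted orders\<close>

lemma perm_le_iff:
  assumes "a \<in> {1..n} \<rightarrow> {1..n}" "u permutes {1..n}" "v permutes {1..n}"
  shows "perm_le n a u v \<longleftrightarrow> (\<forall>k\<in>{1..n}. max_excess n (u ` {1..k}) (v ` {1..k}) =
           pref_diff (u ` {1..k}) (v ` {1..k}) (a k))"
  unfolding perm_le_def
proof (intro ball_cong refl subset_le_iff)
  fix k assume k: "k \<in> {1..n}"
  show "a k \<in> {1..n}" using assms(1) k by blast
  show "u ` {1..k} \<subseteq> {1..n}" "v ` {1..k} \<subseteq> {1..n}"
    using k by (intro prefix_subset[OF assms(2)] prefix_subset[OF assms(3)]; simp)+
  show "card (u ` {1..k}) = card (v ` {1..k})" by (simp only: prefix_card[OF assms(2)] prefix_card[OF assms(3)])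
qed

text \<open>Lengths telescope, so the distances add up iff the nonnegative defects of the triangle
  inequality for the maxima sum to zero. Then each defect vanishes, and
  \<open>max_excess_split_iff\<close> applies at \<open>a k\<close>.\<close>

lemma qb_dist_split_iff:
  assumes a: "a \<in> {1..n} \<rightarrow> {1..n}" and uv: "perm_le n a u v"
    and u: "u permutes {1..n}" and v: "v permutes {1..n}" and w: "w permutes {1..n}"
  shows "qb_dist n u w + qb_dist n w v = qb_dist n u v \<longleftrightarrow> perm_le n a u w \<and> perm_le n a w v"
proof -
  let ?d = "\<lambda>u v k. max_excess n (u ` {1..k}) (v ` {1..k})"
  have "qb_dist n u w + qb_dist n w v = qb_dist n u v \<longleftrightarrow>
        int (qb_dist n u w) + int (qb_dist n w v) = int (qb_dist n u v)" by linarith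
  also have "\<dots> \<longleftrightarrow> (\<Sum>k\<in>{1..n}. ?d u w k + ?d w v k - ?d u v k) = 0"
    by (auto simp: qb_dist_eq_weight[OF u v] qb_dist_eq_weight[OF u w] qb_dist_eq_weight[OF w v]
        qb_weight_def sum.distrib sum_subtractf)
  also have "\<dots> \<longleftrightarrow> (\<forall>k\<in>{1..n}. ?d u w k + ?d w v k - ?d u v k = 0)"
    by (rule sum_nonneg_eq_0_iff) (auto simp: max_excess_triangle)
  also have "\<dots> \<longleftrightarrow> perm_le n a u w \<and> perm_le n a w v"
  proof -
    have "?d u w k + ?d w v k - ?d u v k = 0 \<longleftrightarrow>
        ?d u w k = pref_diff (u ` {1..k}) (w ` {1..k}) (a k) \<and>
        ?d w v k = pref_diff (w ` {1..k}) (v ` {1..k}) (a k)" if k: "k \<in> {1..n}" for k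
      using max_excess_split_iff[of "a k" n "u ` {1..k}" "v ` {1..k}" "w ` {1..k}"]
        funcset_mem[OF a k] k uv unfolding perm_le_iff[OF a u v] by auto
    then show ?thesis unfolding perm_le_iff[OF a u w] perm_le_iff[OF a w v] by blast
  qed
  finally show ?thesis .
qed

text \<open>One shift vector serves the whole chain: splitting at \<open>x\<close> makes it
  admissible for \<open>x\<close> and \<open>v\<close>, and that pair can be split at
  \<open>y\<close>.\<close>

lemma tilted_le_iff:
  assumes a: "a \<in> {1..n} \<rightarrow> {1..n}" and uv: "perm_le n a u v"
    and u: "u permutes {1..n}" and v: "v permutes {1..n}"
  shows "x \<in> tilted_interval n u v \<and> y \<in> tilted_interval n u v \<and> tilted_le n u v x y \<longleftrightarrow>
    x permutes {1..n} \<and> y permutes {1..n} \<and> perm_le n a u x \<and> perm_le n a x y \<and> perm_le n a y v"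
    (is "?L \<longleftrightarrow> ?R")
proof
  assume L: ?L
  then have x: "x permutes {1..n}" and y: "y permutes {1..n}" by (auto simp: tilted_interval_def)
  have ux: "perm_le n a u x" and xv: "perm_le n a x v"
    using L qb_dist_split_iff[OF a uv u v x] by (auto simp: tilted_interval_def)
  have "qb_dist n x y + qb_dist n y v = qb_dist n x v"
    using L by (auto simp: tilted_interval_def tilted_le_def)
  then show ?R using qb_dist_split_iff[OF a xv x v y] x y ux by simp
next
  assume R: ?R
  have x: "x permutes {1..n}" and y: "y permutes {1..n}" using R by auto
  \<comment> \<open>For a fixed shift the relation is transitive: excesses at \<open>a k\<close>
    add, and they bound the subadditive maximum from below.\<close>
  have trans: "perm_le n a p r" if "perm_le n a p q" "perm_le n a q r"
    "p permutes {1..n}" "q permutes {1..n}" "r permutes {1..n}" for p q r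
    unfolding perm_le_iff[OF a that(3,5)]
  proof
    fix k assume k: "k \<in> {1..n}"
    let ?p = "p ` {1..k}" and ?q = "q ` {1..k}" and ?r = "r ` {1..k}"
    have "max_excess n ?p ?q = pref_diff ?p ?q (a k)" "max_excess n ?q ?r = pref_diff ?q ?r (a k)"
      using that(1,2) k unfolding perm_le_iff[OF a that(3,4)] perm_le_iff[OF a that(4,5)] by blast+
    then show "max_excess n ?p ?r = pref_diff ?p ?r (a k)"
      using max_excess_triangle[of n ?p ?r ?q] max_excess_ge[of "a k" n ?p ?r] k a
        pref_diff_trans[of ?p ?r "a k" ?q] by (auto simp: Pi_iff)
  qed
  have xv: "perm_le n a x v" using trans[of x y v] R v by blast
  have uy: "perm_le n a u y" using trans[of u x y] R u by blast
  have "qb_dist n u x + qb_dist n x v = qb_dist n u v" "qb_dist n u y + qb_dist n y v = qb_dist n u v"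
    "qb_dist n x y + qb_dist n y v = qb_dist n x v"
    using qb_dist_split_iff[OF a uv u v x] qb_dist_split_iff[OF a uv u v y]
      qb_dist_split_iff[OF a xv x v y] R xv uy by auto
  then show ?L using x y by (auto simp: tilted_interval_def tilted_le_def)
qed

section \<open>Coordinate ranks of a flag\<close>

text \<open>Rank-nullity for \<open>x \<mapsto> N *\<^sub>v x\<close>, whose image is the column
  space.\<close>

lemma rank_plus_kernel_dim:
  fixes N :: "'a :: field mat"
  assumes N: "N \<in> carrier_mat r k"
  shows "vec_space.rank r N +
    vectorspace.dim class_ring ((module_vec TYPE('a) k)\<lparr>carrier := mat_kernel N\<rparr>) = k"
proof -
  interpret K: vec_space "TYPE('a)" k .
  interpret R: vec_space "TYPE('a)" r .
  have hom: "(\<lambda>x. N *\<^sub>v x) \<in> LinearCombinations.module_hom class_ring K.V R.V"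
    using N by (auto simp: LinearCombinations.module_hom_def module_vec_simps class_ring_simps
        mult_add_distrib_mat_vec mult_mat_vec)
  interpret linear_map class_ring K.V R.V "\<lambda>x. N *\<^sub>v x"
    by unfold_locales (rule hom)
  have dims: "dim_row N = r" "dim_col N = k" using N by auto
  have im: "imT = R.span (set (cols N))"
    unfolding im_def R.col_space_eq[OF N, unfolded R.col_space_def dims]
    using N by (auto intro: mult_mat_vec_carrier)
  have ker: "kerT = mat_kernel N"
    unfolding ker_def mat_kernel[OF N] by (auto simp: module_vec_simps)
  show ?thesis
    using rank_nullity_main(1)[OF K.fin_dim] unfolding K.dim_is_n im ker R.rank_def .
qed

section \<open>Dimensions of solution spaces\<close>

context vec_space
begin

lemma subspace_solutions:
  assumes "\<And>i. i \<in> I \<Longrightarrow> c i \<in> carrier_vec n"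
  shows "VectorSpace.subspace class_ring {x \<in> carrier_vec n. \<forall>i\<in>I. c i \<bullet> x = 0} V"
  using assms
  by (auto intro!: VectorSpace.subspace.intro submodule.intro vec_vs vec_module
      simp: module_vec_simps class_ring_simps scalar_prod_add_distrib[of _ n])

lemma dim_eq_card_basis:
  assumes W: "VectorSpace.subspace class_ring W V"
    and B: "finite B" "B \<subseteq> W" "lin_indpt B" "span B = W"
  shows "vectorspace.dim class_ring (vs W) = card B"
proof -
  have sm: "submodule class_ring W V" using W by simp
  interpret W: vectorspace class_ring "vs W" using W by (rule subspace_is_vs)
  have "W.basis B"
    using B span_li_not_depend[OF B(2) sm] by (simp add: W.basis_def)
  then show ?thesis using W.dim_basis B(1) by simp
qed

text \<open>If some \<open>z\<close> in \<open>W\<close> has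
  \<open>c \<bullet> z \<noteq> 0\<close>, every vector of \<open>W\<close> is a solution plus a
  multiple of \<open>z\<close>, so \<open>z\<close> extends a basis of the solutions to one of
  \<open>W\<close>.\<close>

lemma dim_subspace_hyperplane:
  assumes W: "VectorSpace.subspace class_ring W V" and c: "c \<in> carrier_vec n"
    and W': "VectorSpace.subspace class_ring {x \<in> W. c \<bullet> x = 0} V"
  shows "vectorspace.dim class_ring (vs W) = vectorspace.dim class_ring (vs {x \<in> W. c \<bullet> x = 0}) +
           (if \<forall>x\<in>W. c \<bullet> x = 0 then 0 else 1)"
proof (cases "\<forall>x\<in>W. c \<bullet> x = 0")
  case True
  then have "{x \<in> W. c \<bullet> x = 0} = W" by auto
  then show ?thesis using True by simp
next
  case False
  let ?W' = "{x \<in> W. c \<bullet> x = 0}"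
  obtain z where z: "z \<in> W" "c \<bullet> z \<noteq> 0" using False by blast
  have smW: "submodule class_ring W V" using W by simp
  then have Wc: "W \<subseteq> carrier_vec n" by (simp add: submodule_def)
  have closed: "x + y \<in> W" "a \<cdot>\<^sub>v x \<in> W" if "x \<in> W" "y \<in> W" for x y a
    using that smW by (auto simp: submodule_def class_ring_simps module_vec_simps)
  obtain B where B: "finite B" "B \<subseteq> ?W'" "lin_indpt B" "span B = ?W'"
    "card B = vectorspace.dim class_ring (vs ?W')"
    using subspace_basis_exists[OF W'] .
  have zB: "z \<notin> span B" "z \<notin> B" using z B by auto
  have Bc: "B \<subseteq> carrier_vec n" using B Wc by auto
  have zc: "z \<in> carrier_vec n" using z Wc by auto
  have ind: "lin_indpt (insert z B)"
    using lin_dep_iff_in_span[OF Bc B(3) zc zB(2)] zB by simp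
  have sp: "span (insert z B) = W"
  proof
    show "span (insert z B) \<subseteq> W"
      by (rule span_is_subset[OF _ smW]) (use z B in auto)
    show "W \<subseteq> span (insert z B)"
    proof
      fix w assume w: "w \<in> W"
      have wc: "w \<in> carrier_vec n" using w Wc by auto
      \<comment> \<open>The coefficient for which \<open>w - b z\<close> solves the
        equation.\<close>
      define b where "b = (c \<bullet> w) / (c \<bullet> z)"
      define y where "y = w + (- b) \<cdot>\<^sub>v z"
      have y: "y \<in> W" unfolding y_def using closed w z by blast
      have "c \<bullet> y = c \<bullet> w + c \<bullet> ((- b) \<cdot>\<^sub>v z)"
        unfolding y_def using c wc zc by (intro scalar_prod_add_distrib[of _ n]) auto
      also have "\<dots> = 0" using c zc z(2) by (simp add: b_def)
      finally have "y \<in> span B" using y B(4) by simp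
      then have "y \<in> span (insert z B)" using span_is_monotone[of B "insert z B"] by auto
      moreover have "b \<cdot>\<^sub>v z \<in> span (insert z B)"
        using Bc zc by (intro smult_in_span span_mem) auto
      ultimately have "y + b \<cdot>\<^sub>v z \<in> span (insert z B)"
        using Bc zc by (intro span_add1[of "insert z B", simplified]) (auto simp: module_vec_simps)
      also have "y + b \<cdot>\<^sub>v z = w" using wc zc by (intro eq_vecI) (auto simp: y_def)
      finally show "w \<in> span (insert z B)" .
    qed
  qed
  have "vectorspace.dim class_ring (vs W) = card (insert z B)"
    by (rule dim_eq_card_basis[OF W _ _ ind sp]) (use z B in auto)
  then show ?thesis using B(1,5) zB(2) False by simp
qed

end

section \<open>Ranks of submatrices of the first columns\<close>

definition leading_row :: "complex mat \<Rightarrow> nat \<Rightarrow> nat \<Rightarrow> complex vec" where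
  "leading_row M k i = vec k (\<lambda>j. M $$ (i, j))"

lemma leading_row_carrier [simp]: "leading_row M k i \<in> carrier_vec k"
  by (simp add: leading_row_def)

lemma submatrix_leading_carrier:
  assumes "M \<in> carrier_mat n n" "k \<le> n"
  shows "submatrix M I {..<k} \<in> carrier_mat (card {i. i < n \<and> i \<in> I}) k"
proof (rule carrier_matI)
  have "{j. j < n \<and> j \<in> {..<k}} = {..<k}" using assms(2) by auto
  then show "dim_col (submatrix M I {..<k}) = k"
    using assms(1) by (simp add: dim_submatrix)
  show "dim_row (submatrix M I {..<k}) = card {i. i < n \<and> i \<in> I}"
    using assms(1) by (simp add: dim_submatrix)
qed

lemma row_submatrix_leading:
  assumes M: "M \<in> carrier_mat n n" and k: "k \<le> n" and i: "i < card {i. i < n \<and> i \<in> I}"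
  shows "row (submatrix M I {..<k}) i = leading_row M k (pick I i)"
proof (rule eq_vecI)
  have N: "submatrix M I {..<k} \<in> carrier_mat (card {i. i < n \<and> i \<in> I}) k"
    by (rule submatrix_leading_carrier[OF M k])
  then show "dim_vec (row (submatrix M I {..<k}) i) = dim_vec (leading_row M k (pick I i))"
    by (simp add: leading_row_def)
  fix j assume "j < dim_vec (leading_row M k (pick I i))"
  then have j: "j < k" by (simp add: leading_row_def)
  have "{a \<in> {..<k}. a < j} = {..<j}" using j by auto
  then have pick: "pick {..<k} j = j" using pick_card_in_set[of j "{..<k}"] j by simp
  have "{j. j < n \<and> j \<in> {..<k}} = {..<k}" using k by auto
  then show "row (submatrix M I {..<k}) i $ j = leading_row M k (pick I i) $ j"
    using submatrix_index[of i M I j "{..<k}"] M N i j pick by (simp add: leading_row_def)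
qed

text \<open>\<open>pick I\<close> enumerates \<open>I\<close> increasingly; an element
  \<open>i < n\<close> of \<open>I\<close> has as its index the number of smaller elements.\<close>

lemma ball_pick_iff:
  "(\<forall>i<card {i. i < n \<and> i \<in> I}. P (pick I i)) \<longleftrightarrow> (\<forall>i<n. i \<in> I \<longrightarrow> P i)"
proof safe
  let ?J = "{i. i < n \<and> i \<in> I}"
  fix i assume *: "\<forall>i<card ?J. P (pick I i)" and i: "i < n" "i \<in> I"
  have "{a \<in> I. a < i} \<subset> ?J" using i by auto
  then have "card {a \<in> I. a < i} < card ?J" by (intro psubset_card_mono) auto
  then show "P i" using * pick_card_in_set[OF i(2)] by metis
next
  let ?J = "{i. i < n \<and> i \<in> I}"
  fix i assume *: "\<forall>i<n. i \<in> I \<longrightarrow> P i" and i: "i < card ?J"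
  have "pick I i = pick ?J i" by (rule pick_reduce_set[OF i])
  also have "\<dots> \<in> ?J" using pick_in_set_le[OF i] .
  finally show "P (pick I i)" using * by simp
qed

lemma mat_kernel_submatrix_leading:
  assumes M: "M \<in> carrier_mat n n" and k: "k \<le> n"
  shows "mat_kernel (submatrix M I {..<k}) =
    {x \<in> carrier_vec k. \<forall>i\<in>{i. i < n \<and> i \<in> I}. leading_row M k i \<bullet> x = 0}"
proof -
  define N where "N = submatrix M I {..<k}"
  define r where "r = card {i. i < n \<and> i \<in> I}"
  have N: "N \<in> carrier_mat r k" unfolding N_def r_def by (rule submatrix_leading_carrier[OF M k])
  have "N *\<^sub>v x = 0\<^sub>v r \<longleftrightarrow> (\<forall>i\<in>{i. i < n \<and> i \<in> I}. leading_row M k i \<bullet> x = 0)"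
    if "x \<in> carrier_vec k" for x
  proof -
    have "N *\<^sub>v x = 0\<^sub>v r \<longleftrightarrow> (\<forall>i<r. (N *\<^sub>v x) $ i = 0)"
      using N unfolding vec_eq_iff by simp
    also have "\<dots> \<longleftrightarrow> (\<forall>i<r. leading_row M k (pick I i) \<bullet> x = 0)"
      using N row_submatrix_leading[OF M k, of _ I] by (auto simp: N_def r_def)
    also have "\<dots> \<longleftrightarrow> (\<forall>i<n. i \<in> I \<longrightarrow> leading_row M k i \<bullet> x = 0)"
      unfolding r_def by (rule ball_pick_iff)
    finally show ?thesis by blast
  qed
  then show ?thesis unfolding N_def[symmetric] mat_kernel[OF N] by blast
qed

text \<open>The kernel of the submatrix with rows \<open>S\<close>; \<open>i - 1\<close> translates
  the letters \<open>1, ..., n\<close> into row indices.\<close>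

definition leading_solutions :: "complex mat \<Rightarrow> nat \<Rightarrow> nat set \<Rightarrow> complex vec set" where
  "leading_solutions M k S = {x \<in> carrier_vec k. \<forall>i\<in>S. leading_row M k (i - 1) \<bullet> x = 0}"

lemma submatrix_rank_plus_solutions:
  assumes M: "M \<in> carrier_mat n n" and k: "k \<le> n" and S: "S \<subseteq> {1..n}"
  shows "submatrix_rank S k M + vectorspace.dim class_ring
     ((module_vec TYPE(complex) k)\<lparr>carrier := leading_solutions M k S\<rparr>) = k"
proof -
  let ?I = "{i. Suc i \<in> S}"
  have N: "submatrix M ?I {..<k} \<in> carrier_mat (card {i. i < n \<and> i \<in> ?I}) k"
    by (rule submatrix_leading_carrier[OF M k])
  have "(\<forall>i\<in>{i. i < n \<and> i \<in> ?I}. P i) \<longleftrightarrow> (\<forall>i\<in>S. P (i - 1))" for P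
  proof safe
    fix i assume "\<forall>i\<in>{i. i < n \<and> i \<in> ?I}. P i" "i \<in> S"
    moreover have "i \<in> {1..n}" using \<open>i \<in> S\<close> S by blast
    then have "i - 1 < n" "Suc (i - 1) = i" by auto
    ultimately show "P (i - 1)" by auto
  qed force
  then have "mat_kernel (submatrix M ?I {..<k}) = leading_solutions M k S"
    unfolding mat_kernel_submatrix_leading[OF M k] leading_solutions_def by simp
  then show ?thesis
    using rank_plus_kernel_dim[OF N] N by (simp add: submatrix_rank_def Let_def)
qed

text \<open>This says that \<open>i\<close> lies in the closure of \<open>S\<close> in the matroid of \<open>F k\<close>.\<close>

definition in_flag_closure :: "(nat \<Rightarrow> complex vec set) \<Rightarrow> nat \<Rightarrow> nat set \<Rightarrow> nat \<Rightarrow> bool" where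
  "in_flag_closure F k S i \<longleftrightarrow> (\<forall>f\<in>F k. (\<forall>s\<in>S. f $ (s - 1) = 0) \<longrightarrow> f $ (i - 1) = 0)"

lemma in_flag_closure_mono: "S \<subseteq> T \<Longrightarrow> in_flag_closure F k S i \<Longrightarrow> in_flag_closure F k T i"
  unfolding in_flag_closure_def by blast

text \<open>\<open>F k\<close> has fewer vectors to test than \<open>F (Suc k)\<close>. This is what
  makes the bases for consecutive \<open>k\<close> nested.\<close>

lemma in_flag_closure_Suc:
  "F \<in> complete_flags n \<Longrightarrow> k < n \<Longrightarrow> in_flag_closure F (Suc k) S i \<Longrightarrow> in_flag_closure F k S i"
  unfolding in_flag_closure_def complete_flags_def by blast

text \<open>Parametrises \<open>F k\<close> by coefficient vectors, so that vanishing coordinates of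
  a flag vector become linear equations in \<open>x\<close>.\<close>

lemma represents_flag_leading:
  assumes M: "represents_flag n M F" and k: "k \<le> n"
  shows "F k = (\<lambda>x. vec n (\<lambda>i. leading_row M k i \<bullet> x)) ` carrier_vec k"
proof -
  interpret vec_space "TYPE(complex)" n .
  have Mc: "M \<in> carrier_mat n n" using M by (simp add: represents_flag_def)
  define A where "A = mat_of_cols n (take k (cols M))"
  have A: "A \<in> carrier_mat n k" using Mc k by (auto simp: A_def)
  have dims: "dim_row A = n" "dim_col A = k" using A by auto
  have cA: "cols A = take k (cols M)"
    unfolding A_def using Mc by (intro cols_mat_of_cols) (metis cols_dim carrier_matD(1) set_take_subset subset_trans)
  have row: "row A i = leading_row M k i" if "i < n" for i
    using that A Mc k by (intro eq_vecI) (auto simp: leading_row_def A_def mat_of_cols_index)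
  have mult: "A *\<^sub>v x = vec n (\<lambda>i. leading_row M k i \<bullet> x)" for x
    using A row by (intro eq_vecI) auto
  have "F k = span (set (cols A))" using M k by (simp add: cA represents_flag_def)
  also have "\<dots> = (\<lambda>x. A *\<^sub>v x) ` carrier_vec k"
    unfolding col_space_eq[OF A, unfolded col_space_def dims] using A by (auto intro: mult_mat_vec_carrier)
  finally show ?thesis unfolding mult .
qed

text \<open>By rank-nullity the rank grows exactly when the new row does not vanish on the solutions
  for \<open>S\<close>, i.e. when \<open>i\<close> is outside the closure.\<close>

lemma flag_rank_insert:
  assumes F: "F \<in> complete_flags n" and k: "k \<le> n" and S: "S \<subseteq> {1..n}" and i: "i \<in> {1..n}"
  shows "flag_rank n (insert i S) F k = flag_rank n S F k + (if in_flag_closure F k S i then 0 else 1)"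
proof -
  obtain M where M: "represents_flag n M F" using represents_flag_exists[OF F] by blast
  have Mc: "M \<in> carrier_mat n n" using M by (simp add: represents_flag_def)
  interpret vec_space "TYPE(complex)" k .
  let ?K = "leading_solutions M k S" and ?c = "leading_row M k (i - 1)"
  have K': "leading_solutions M k (insert i S) = {x \<in> ?K. ?c \<bullet> x = 0}"
    by (auto simp: leading_solutions_def)
  have sub: "VectorSpace.subspace class_ring (leading_solutions M k T) V" for T
    unfolding leading_solutions_def by (rule subspace_solutions) simp
  have "in_flag_closure F k S i \<longleftrightarrow> (\<forall>x\<in>?K. ?c \<bullet> x = 0)"
  proof -
    have "s - 1 < n" if "s \<in> insert i S" for s
    proof -
      have "s \<in> {1..n}" using that S i by blast
      then show ?thesis by auto
    qed
    then show ?thesis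
      unfolding in_flag_closure_def represents_flag_leading[OF M k] leading_solutions_def by auto
  qed
  moreover have "vectorspace.dim class_ring (vs ?K) =
      vectorspace.dim class_ring (vs (leading_solutions M k (insert i S))) +
      (if \<forall>x\<in>?K. ?c \<bullet> x = 0 then 0 else 1)"
    unfolding K' by (rule dim_subspace_hyperplane[OF sub]) (use sub[of "insert i S"] K' in auto)
  ultimately show ?thesis
    using submatrix_rank_plus_solutions[OF Mc k S] submatrix_rank_plus_solutions[OF Mc k, of "insert i S"] S i
    by (auto simp: flag_rank_eq[OF M k])
qed

lemma flag_rank_empty:
  assumes F: "F \<in> complete_flags n" and k: "k \<le> n"
  shows "flag_rank n {} F k = 0"
proof -
  obtain M where M: "represents_flag n M F" using represents_flag_exists[OF F] by blast
  have Mc: "M \<in> carrier_mat n n" using M by (simp add: represents_flag_def)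
  interpret vec_space "TYPE(complex)" k .
  have "leading_solutions M k {} = carrier_vec k" by (simp add: leading_solutions_def)
  moreover have "V\<lparr>carrier := carrier_vec k\<rparr> = V" by (simp add: module_vec_def)
  ultimately have "submatrix_rank {} k M + k = k"
    using submatrix_rank_plus_solutions[OF Mc k, of "{}"] dim_is_n by (metis empty_subsetI)
  then show ?thesis by (simp add: flag_rank_eq[OF M k])
qed

lemma flag_rank_full:
  assumes F: "F \<in> complete_flags n" and k: "k \<le> n"
  shows "flag_rank n {1..n} F k = k"
proof -
  obtain M where M: "represents_flag n M F" using represents_flag_exists[OF F] by blast
  have Mc: "M \<in> carrier_mat n n" using M by (simp add: represents_flag_def)
  interpret vec_space "TYPE(complex)" n .
  define A where "A = mat_of_cols n (take k (cols M))"
  have cA: "cols A = take k (cols M)"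
    unfolding A_def using Mc by (intro cols_mat_of_cols) (metis cols_dim carrier_matD(1) set_take_subset subset_trans)
  let ?I = "{i. Suc i \<in> {1..n}}"
  have card: "card {i. i < n \<and> i \<in> ?I} = n"
  proof -
    have "{i. i < n \<and> i \<in> ?I} = {..<n}" by auto
    then show ?thesis by simp
  qed
  have N: "submatrix M ?I {..<k} \<in> carrier_mat n k"
    using submatrix_leading_carrier[OF Mc k, of ?I] unfolding card .
  have A: "A \<in> carrier_mat n k" using Mc k by (auto simp: A_def)
  have "submatrix M ?I {..<k} = A"
  proof (rule eq_rowI)
    fix i assume "i < dim_row A"
    then have i: "i < n" using A by simp
    then have "{a \<in> ?I. a < i} = {..<i}" by auto
    then have "pick ?I i = i" using pick_card_in_set[of i ?I] i by simp
    then have "row (submatrix M ?I {..<k}) i = leading_row M k i"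
      using row_submatrix_leading[OF Mc k, of i ?I] i card by simp
    also have "\<dots> = row A i"
      using i A Mc k by (intro eq_vecI) (auto simp: leading_row_def A_def mat_of_cols_index)
    finally show "row (submatrix M ?I {..<k}) i = row A i" .
  qed (use N A in auto)
  then have "flag_rank n {1..n} F k = vectorspace.dim class_ring (vs (span (set (cols A))))"
    using A unfolding flag_rank_eq[OF M k] submatrix_rank_def Let_def by (simp add: rank_def)
  also have "span (set (cols A)) = F k" using M k by (simp add: cA represents_flag_def)
  finally show ?thesis using F k by (auto simp: complete_flags_def)
qed

section \<open>Greedy bases and separators\<close>

lemma cyc_interval_subset: "a \<in> {1..n} \<Longrightarrow> x \<in> {1..n} \<Longrightarrow> cyc_interval n a x \<subseteq> {1..n}"
  by (auto simp: cyc_interval_def)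

lemma cyc_interval_self [simp]: "cyc_interval n a a = {}"
  by (simp add: cyc_interval_def)

lemma cyc_interval_compl:
  assumes "a \<in> {1..n}" "x \<in> {1..n}" "a \<noteq> x"
  shows "cyc_interval n x a = {1..n} - cyc_interval n a x"
  using assms by (auto simp: cyc_interval_def)

text \<open>\<open>[a, b)\<close> and \<open>[a, x)\<close> are initial segments for the same order,
  so one contains the other. Accordingly \<open>[b, x)\<close> arises by removing
  \<open>[a, b)\<close> or by adding its complement.\<close>

lemma cyc_interval_rebase:
  assumes "a \<in> {1..n}" "b \<in> {1..n}" "x \<in> {1..n}"
  shows "cyc_interval n a b \<subseteq> cyc_interval n a x \<and>
           cyc_interval n b x = cyc_interval n a x - cyc_interval n a b \<or>
         cyc_interval n a x \<subseteq> cyc_interval n a b \<and>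
           cyc_interval n b x = cyc_interval n a x \<union> ({1..n} - cyc_interval n a b)"
  using assms by (auto simp: cyc_interval_def)

text \<open>Equal counts make the excess constant, and it is 0 at 1. Membership of \<open>i\<close>
  is then read off as a jump of the prefix count.\<close>

lemma eq_if_cyc_counts_eq:
  assumes A: "A \<subseteq> {1..n}" and B: "B \<subseteq> {1..n}" and c: "card A = card B" and a: "a \<in> {1..n}"
    and eq: "\<And>x. x \<in> {1..n} \<Longrightarrow> card (A \<inter> cyc_interval n a x) = card (B \<inter> cyc_interval n a x)"
  shows "A = B"
proof -
  have const: "pref_diff A B x = pref_diff A B a" if "x \<in> {1..n}" for x
    using pref_diff_cyc_interval[OF A B c a that] eq[OF that] by simp
  have "pref_diff A B a = 0" using const[of 1] a by simp
  then have zero: "pref_diff A B x = 0" if "x \<in> {1..Suc n}" for x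
    using that const[of x] pref_diff_last[OF A B c] by (cases "x = Suc n") auto
  have "i \<in> Z \<longleftrightarrow> card (Z \<inter> {1..<Suc i}) \<noteq> card (Z \<inter> {1..<i})" if "i \<in> {1..n}" for i and Z :: "nat set"
  proof -
    have "{1..<Suc i} = insert i {1..<i}" using that by auto
    then show ?thesis by (auto simp: Int_insert_right)
  qed
  moreover have "card (A \<inter> {1..<x}) = card (B \<inter> {1..<x})" if "x \<in> {1..Suc n}" for x
    using zero[OF that] by (simp add: pref_diff_def)
  ultimately have "i \<in> A \<longleftrightarrow> i \<in> B" if "i \<in> {1..n}" for i
    using that by (metis Suc_le_mono atLeastAtMost_iff le_SucI)
  then show ?thesis using A B by blast
qed

text \<open>A matroid of rank \<open>k\<close> on \<open>{1..n}\<close> through its rank function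
  and closure. It isolates what is needed of the coordinate matroid of a single
  \<open>F k\<close>.\<close>

locale ground_rank =
  fixes n k :: nat and r :: "nat set \<Rightarrow> nat" and cl :: "nat set \<Rightarrow> nat \<Rightarrow> bool"
  assumes r_empty: "r {} = 0" and r_full: "r {1..n} = k"
    and r_insert: "S \<subseteq> {1..n} \<Longrightarrow> i \<in> {1..n} \<Longrightarrow> r (insert i S) = r S + (if cl S i then 0 else 1)"
    and cl_mono: "S \<subseteq> T \<Longrightarrow> cl S i \<Longrightarrow> cl T i"
begin

text \<open>By monotonicity of the closure, an element of \<open>U\<close> raises the rank of the
  larger set by no more than that of the smaller one.\<close>

lemma submodular:
  assumes "S \<subseteq> T" "T \<subseteq> {1..n}" "U \<subseteq> {1..n}"
  shows "r (T \<union> U) + r S \<le> r (S \<union> U) + r T"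
proof -
  have "finite U" using assms(3) finite_subset by blast
  then show ?thesis using assms(3)
  proof (induction U)
    case (insert i U)
    have "r (T \<union> insert i U) = r (T \<union> U) + (if cl (T \<union> U) i then 0 else 1)"
      "r (S \<union> insert i U) = r (S \<union> U) + (if cl (S \<union> U) i then 0 else 1)"
      using r_insert[of "T \<union> U" i] r_insert[of "S \<union> U" i] insert.prems assms by simp_all
    moreover have "cl (S \<union> U) i \<Longrightarrow> cl (T \<union> U) i"
      using assms(1) by (intro cl_mono[of "S \<union> U" "T \<union> U"]) auto
    ultimately show ?case using insert by auto
  qed simp
qed

lemma subadditive: "S \<subseteq> {1..n} \<Longrightarrow> T \<subseteq> {1..n} \<Longrightarrow> r (S \<union> T) \<le> r S + r T"
  using submodular[of "{}" S T] by (simp add: r_empty)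

lemma rank_compl_ge: "S \<subseteq> {1..n} \<Longrightarrow> k \<le> r S + r ({1..n} - S)"
  using subadditive[of S "{1..n} - S"] r_full by (simp add: Un_absorb1)

text \<open>Submodularity with the complement of \<open>J\<close> adjoined to \<open>U\<close> and
  to \<open>J \<union> U\<close>. The matroid is a direct sum along \<open>J\<close>.\<close>

lemma separator_disjoint:
  assumes J: "J \<subseteq> {1..n}" and sep: "r J + r ({1..n} - J) = k" and U: "U \<subseteq> {1..n} - J"
  shows "r (U \<union> J) = r U + r J"
proof -
  have "r ((J \<union> U) \<union> ({1..n} - J)) + r U \<le> r (U \<union> ({1..n} - J)) + r (J \<union> U)"
    using J U by (intro submodular) auto
  moreover have "(J \<union> U) \<union> ({1..n} - J) = {1..n}" "U \<union> ({1..n} - J) = {1..n} - J" using J U by auto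
  ultimately have "r J + r U \<le> r (J \<union> U)" using sep r_full by simp
  moreover have "r (U \<union> J) \<le> r U + r J" using J U by (intro subadditive) auto
  ultimately show ?thesis by (simp add: Un_commute)
qed

text \<open>\<open>R\<close> is \<open>\<le>\<close> for the closed and \<open>=\<close> for the
  open variety, so that a change of shift is treated once for both.\<close>

definition rank_cond :: "(nat \<Rightarrow> nat \<Rightarrow> bool) \<Rightarrow> nat \<Rightarrow> nat set \<Rightarrow> nat set \<Rightarrow> bool" where
  "rank_cond R a A B \<longleftrightarrow> (\<forall>i\<in>{1..n}.
     R (r (cyc_interval n a i)) (card (A \<inter> cyc_interval n a i)) \<and>
     R (r (cyc_interval n i a)) (card (B \<inter> cyc_interval n i a)))"

lemma rank_cond_iff:
  assumes R: "R = (\<le>) \<or> R = (=)" and a: "a \<in> {1..n}" and B: "B \<subseteq> {1..n}" "card B = k"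
  shows "rank_cond R a A B \<longleftrightarrow> (\<forall>i\<in>{1..n}.
     R (r (cyc_interval n a i)) (card (A \<inter> cyc_interval n a i)) \<and>
     R (r ({1..n} - cyc_interval n a i)) (card (B - cyc_interval n a i)))"
  unfolding rank_cond_def
proof (intro ball_cong refl conj_cong)
  fix i assume i: "i \<in> {1..n}"
  show "R (r (cyc_interval n i a)) (card (B \<inter> cyc_interval n i a)) =
        R (r ({1..n} - cyc_interval n a i)) (card (B - cyc_interval n a i))"
  \<comment> \<open>For \<open>i = a\<close> the interval is empty rather than the complement of the
    empty set, but both versions of the condition hold.\<close>
  proof (cases "i = a")
    case True
    then show ?thesis using R r_empty r_full B by auto
  next
    case False
    have "B \<inter> ({1..n} - cyc_interval n a i) = B - cyc_interval n a i" using B by auto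
    then show ?thesis using cyc_interval_compl[OF a i] False by simp
  qed
qed

text \<open>Equal excess at \<open>a\<close> and \<open>b\<close> means that \<open>A\<close> and
  \<open>B\<close> have equally many elements in \<open>J\<close>. The bounds on \<open>J\<close>
  and its complement then sum to \<open>k\<close>, while subadditivity gives at least
  \<open>k\<close>, so all of them are equalities.\<close>

lemma rank_cond_separator:
  assumes a: "a \<in> {1..n}" and b: "b \<in> {1..n}"
    and A: "A \<subseteq> {1..n}" "card A = k" and B: "B \<subseteq> {1..n}" "card B = k"
    and eq: "pref_diff A B a = pref_diff A B b"
    and le: "rank_cond (\<le>) a A B"
  defines "J \<equiv> cyc_interval n a b"
  shows "r J + r ({1..n} - J) = k" "card (A \<inter> J) = r J" "card (B \<inter> J) = r J"
    "card (A - J) = r ({1..n} - J)" "card (B - J) = r ({1..n} - J)"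
proof -
  have fin: "finite A" "finite B" using A B finite_subset by blast+
  have J: "J \<subseteq> {1..n}" unfolding J_def by (rule cyc_interval_subset[OF a b])
  have AB: "card (A \<inter> J) = card (B \<inter> J)"
    using pref_diff_cyc_interval[of A n B a b] A B a b eq by (simp add: J_def)
  have cA: "card (A \<inter> J) + card (A - J) = k" "card (B \<inter> J) + card (B - J) = k"
    using card_Int_Diff[OF fin(1), of J] card_Int_Diff[OF fin(2), of J] A B by simp_all
  have "r J \<le> card (A \<inter> J)" "r ({1..n} - J) \<le> card (B - J)"
    using le b unfolding J_def rank_cond_iff[OF disjI1[OF refl] a B] by auto
  then show "r J + r ({1..n} - J) = k" "card (A \<inter> J) = r J" "card (B \<inter> J) = r J"
    "card (A - J) = r ({1..n} - J)" "card (B - J) = r ({1..n} - J)"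
    using AB cA rank_compl_ge[OF J] by linarith+
qed

text \<open>Ranks and counts both split along the separator \<open>J\<close> and agree on its two
  sides. The condition for \<open>[b, x)\<close> is the one for \<open>[a, x)\<close> with equal
  amounts added or removed.\<close>

lemma rank_cond_rebase:
  assumes R: "R = (\<le>) \<or> R = (=)" and a: "a \<in> {1..n}" and b: "b \<in> {1..n}"
    and A: "A \<subseteq> {1..n}" "card A = k" and B: "B \<subseteq> {1..n}" "card B = k"
    and eq: "pref_diff A B a = pref_diff A B b"
    and cond: "rank_cond R a A B"
  shows "rank_cond R b A B"
  unfolding rank_cond_iff[OF R b B]
proof (intro ballI)
  fix x assume x: "x \<in> {1..n}"
  define J where "J = cyc_interval n a b"
  define K where "K = {1..n} - J"
  define I where "I = cyc_interval n a x"
  define T where "T = cyc_interval n b x"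
  have fin: "finite A" "finite B" using A B finite_subset by blast+
  have sub: "J \<subseteq> {1..n}" "I \<subseteq> {1..n}" "T \<subseteq> {1..n}" "K \<subseteq> {1..n}"
    unfolding J_def I_def T_def K_def using cyc_interval_subset a b x by auto
  have "rank_cond (\<le>) a A B" using R cond by (auto simp: rank_cond_def)
  note sep = rank_cond_separator[OF a b A B eq this, folded J_def, folded K_def]
  have K_compl: "{1..n} - K = J" using sub by (auto simp: K_def)
  have addJ: "r (U \<union> J) = r U + r J" if "U \<subseteq> K" for U
    using separator_disjoint[OF sub(1) _ that[unfolded K_def]] sep(1) by (simp add: K_def)
  have addK: "r (U \<union> K) = r U + r K" if "U \<subseteq> J" for U
    using separator_disjoint[OF sub(4), of U] sep(1) that unfolding K_compl by simp
  have shift: "R (p + c) (q + c) \<longleftrightarrow> R p q" for p q c using R by auto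
  have split: "card (Z \<inter> (U \<union> W)) = card (Z \<inter> U) + card (Z \<inter> W)"
    if "finite Z" "U \<inter> W = {}" for Z U W :: "nat set"
  proof -
    have "(Z \<inter> U) \<inter> (Z \<inter> W) = {}" using that by auto
    then show ?thesis using that by (simp add: Int_Un_distrib card_Un_disjoint)
  qed
  have compl: "Z - U = Z \<inter> ({1..n} - U)" if "Z \<subseteq> {1..n}" for Z U :: "nat set" using that by auto
  have cards: "card (A \<inter> J) = r J" "card (B \<inter> J) = r J" "card (A \<inter> K) = r K" "card (B \<inter> K) = r K"
    using sep compl[OF A(1), of J] compl[OF B(1), of J] by (simp_all add: K_def)
  have I: "R (r I) (card (A \<inter> I))" "R (r ({1..n} - I)) (card (B \<inter> ({1..n} - I)))"
    using cond x unfolding rank_cond_iff[OF R a B] I_def compl[OF B(1), symmetric] by auto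
  have "R (r T) (card (A \<inter> T)) \<and> R (r ({1..n} - T)) (card (B \<inter> ({1..n} - T)))"
    using cyc_interval_rebase[OF a b x, folded J_def I_def T_def, folded K_def]
  proof (elim disjE conjE)
    assume 1: "J \<subseteq> I" "T = I - J"
    have "T \<subseteq> K" "I = T \<union> J" "T \<inter> J = {}" using 1 sub by (auto simp: K_def)
    moreover have "{1..n} - I \<subseteq> K" "{1..n} - T = ({1..n} - I) \<union> J" "({1..n} - I) \<inter> J = {}"
      using 1 sub by (auto simp: K_def)
    ultimately show ?thesis
      using I addJ[of T] addJ[of "{1..n} - I"] split[OF fin(1), of T J] split[OF fin(2), of "{1..n} - I" J] cards
      by (simp add: shift)
  next
    assume 2: "I \<subseteq> J" "T = I \<union> K"
    have "{1..n} - T \<subseteq> J" "{1..n} - I = ({1..n} - T) \<union> K" "({1..n} - T) \<inter> K = {}" "I \<inter> K = {}"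
      using 2 sub by (auto simp: K_def)
    then show ?thesis
      using I 2 addK[of I] addK[of "{1..n} - T"] split[OF fin(1), of I K] split[OF fin(2), of "{1..n} - T" K] cards
      by (simp add: shift)
  qed
  then show "R (r (cyc_interval n b x)) (card (A \<inter> cyc_interval n b x)) \<and>
      R (r ({1..n} - cyc_interval n b x)) (card (B - cyc_interval n b x))"
    unfolding T_def compl[OF B(1)] by simp
qed

text \<open>The basis produced by the greedy algorithm that scans the elements by increasing
  \<open>f\<close>, for injective \<open>f\<close>.\<close>

definition greedy_basis :: "(nat \<Rightarrow> nat) \<Rightarrow> nat set" where
  "greedy_basis f = {i \<in> {1..n}. \<not> cl {z \<in> {1..n}. f z < f i} i}"

lemma greedy_basis_subset: "greedy_basis f \<subseteq> {1..n}"
  by (auto simp: greedy_basis_def)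

text \<open>Along the initial segments of \<open>f\<close> the rank grows exactly at the members of
  the greedy basis.\<close>

lemma card_greedy_basis_initial:
  assumes f: "inj_on f {1..n}"
  shows "card (greedy_basis f \<inter> {z \<in> {1..n}. f z < p}) = r {z \<in> {1..n}. f z < p}"
proof (induction p)
  case 0
  then show ?case by (simp add: r_empty)
next
  case (Suc p)
  let ?I = "\<lambda>p. {z \<in> {1..n}. f z < p}"
  show ?case
  proof (cases "\<exists>i\<in>{1..n}. f i = p")
    case True
    then obtain i where i: "i \<in> {1..n}" "f i = p" by blast
    have I: "?I (Suc p) = insert i (?I p)"
      using i f by (auto simp: less_Suc_eq dest: inj_onD)
    have "i \<in> greedy_basis f \<longleftrightarrow> \<not> cl (?I p) i" using i by (simp add: greedy_basis_def)
    moreover have "?I p \<subseteq> {1..n}" by auto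
    ultimately show ?thesis
      using Suc r_insert[OF \<open>?I p \<subseteq> {1..n}\<close> i(1)] i(2) unfolding I by (simp add: Int_insert_right)
  next
    case False
    then have "?I (Suc p) = ?I p" by (auto simp: less_Suc_eq)
    then show ?thesis using Suc by simp
  qed
qed

lemma card_greedy_basis:
  assumes f: "inj_on f {1..n}"
  shows "card (greedy_basis f) = k"
proof -
  obtain p where p: "\<forall>z\<in>{1..n}. f z < p"
    using finite_nat_set_iff_bounded[of "f ` {1..n}"] by auto
  then have "{z \<in> {1..n}. f z < p} = {1..n}" by auto
  then show ?thesis
    using card_greedy_basis_initial[OF f, of p] greedy_basis_subset[of f] r_full by (simp add: Int_absorb2)
qed

definition min_basis :: "nat \<Rightarrow> nat set" where
  "min_basis a = greedy_basis (cyc_pos n a)"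

text \<open>Positions are below \<open>n\<close>, so subtracting them from \<open>n\<close> reverses
  the order without truncation.\<close>

definition max_basis :: "nat \<Rightarrow> nat set" where
  "max_basis a = greedy_basis (\<lambda>z. n - cyc_pos n a z)"

lemma cyc_pos_less: "a \<in> {1..n} \<Longrightarrow> z \<in> {1..n} \<Longrightarrow> cyc_pos n a z < n"
  by (auto simp: cyc_pos_def)

lemma inj_on_cyc_pos_rev: "a \<in> {1..n} \<Longrightarrow> inj_on (\<lambda>z. n - cyc_pos n a z) {1..n}"
proof (rule inj_onI)
  fix y z assume a: "a \<in> {1..n}" and yz: "y \<in> {1..n}" "z \<in> {1..n}" "n - cyc_pos n a y = n - cyc_pos n a z"
  then have "cyc_pos n a y = cyc_pos n a z" using cyc_pos_less[OF a yz(1)] cyc_pos_less[OF a yz(2)] by linarith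
  then show "y = z" using inj_onD[OF cyc_pos_inj[OF a]] yz by blast
qed

lemma bases_subset: "min_basis a \<subseteq> {1..n}" "max_basis a \<subseteq> {1..n}"
  unfolding min_basis_def max_basis_def by (rule greedy_basis_subset)+

lemma card_bases:
  assumes "a \<in> {1..n}"
  shows "card (min_basis a) = k" "card (max_basis a) = k"
  unfolding min_basis_def max_basis_def
  using cyc_pos_inj[OF assms] inj_on_cyc_pos_rev[OF assms] by (auto intro: card_greedy_basis)

text \<open>\<open>[a, x)\<close> is an initial segment for the order from \<open>a\<close>, and its
  complement one for the reversed order.\<close>

lemma rank_cond_bases:
  assumes a: "a \<in> {1..n}"
  shows "rank_cond (=) a (min_basis a) (max_basis a)"
  unfolding rank_cond_iff[OF disjI2[OF refl] a bases_subset(2) card_bases(2)[OF a]]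
proof (intro ballI conjI)
  fix x assume x: "x \<in> {1..n}"
  show "r (cyc_interval n a x) = card (min_basis a \<inter> cyc_interval n a x)"
    unfolding min_basis_def cyc_interval_eq_cyc_pos[OF a x]
    by (rule card_greedy_basis_initial[OF cyc_pos_inj[OF a], symmetric])
  let ?f = "\<lambda>z. n - cyc_pos n a z"
  \<comment> \<open>The complement contains \<open>x\<close> itself, hence the
    \<open>Suc\<close>.\<close>
  have "{1..n} - cyc_interval n a x = {z \<in> {1..n}. ?f z < Suc (?f x)}"
    unfolding cyc_interval_eq_cyc_pos[OF a x] using cyc_pos_less[OF a] x by force
  moreover have "max_basis a - cyc_interval n a x = max_basis a \<inter> ({1..n} - cyc_interval n a x)"
    using bases_subset(2) by auto
  ultimately show "r ({1..n} - cyc_interval n a x) = card (max_basis a - cyc_interval n a x)"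
    unfolding max_basis_def using card_greedy_basis_initial[OF inj_on_cyc_pos_rev[OF a]] by simp
qed

text \<open>The ranks fix all counts along intervals from \<open>a\<close>, and these determine the
  sets.\<close>

lemma rank_cond_unique:
  assumes a: "a \<in> {1..n}"
    and A: "A \<subseteq> {1..n}" "card A = k" and B: "B \<subseteq> {1..n}" "card B = k"
    and A': "A' \<subseteq> {1..n}" "card A' = k" and B': "B' \<subseteq> {1..n}" "card B' = k"
    and cond: "rank_cond (=) a A B" "rank_cond (=) a A' B'"
  shows "A = A'" "B = B'"
proof -
  have fin: "finite B" "finite B'" using B B' finite_subset by blast+
  have eq: "card (A \<inter> cyc_interval n a x) = card (A' \<inter> cyc_interval n a x)"
    "card (B - cyc_interval n a x) = card (B' - cyc_interval n a x)" if "x \<in> {1..n}" for x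
    using cond that unfolding rank_cond_iff[OF disjI2[OF refl] a B] rank_cond_iff[OF disjI2[OF refl] a B']
    by metis+
  show "A = A'" using A A' eq(1) by (intro eq_if_cyc_counts_eq[OF _ _ _ a]) auto
  have "card (B \<inter> cyc_interval n a x) = card (B' \<inter> cyc_interval n a x)" if "x \<in> {1..n}" for x
    using eq(2)[OF that] card_Int_Diff[OF fin(1), of "cyc_interval n a x"]
      card_Int_Diff[OF fin(2), of "cyc_interval n a x"] B B' by simp
  then show "B = B'" using B B' by (intro eq_if_cyc_counts_eq[OF _ _ _ a]) auto
qed

text \<open>Ranks are counts in \<open>X\<close> and \<open>Y\<close>, so the rank bounds say
  \<open>A \<le>\<^sub>a X\<close> and \<open>Y \<le>\<^sub>a B\<close>.\<close>

lemma rank_cond_le_iff: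
  assumes a: "a \<in> {1..n}"
    and A: "A \<subseteq> {1..n}" "card A = k" and B: "B \<subseteq> {1..n}" "card B = k"
    and X: "X \<subseteq> {1..n}" "card X = k" and Y: "Y \<subseteq> {1..n}" "card Y = k"
    and XY: "rank_cond (=) a X Y"
  shows "rank_cond (\<le>) a A B \<longleftrightarrow>
    max_excess n A X = pref_diff A X a \<and> max_excess n Y B = pref_diff Y B a"
proof -
  have fin: "finite B" "finite Y" using B Y finite_subset by blast+
  have rk: "r (cyc_interval n a x) = card (X \<inter> cyc_interval n a x)"
    "r ({1..n} - cyc_interval n a x) = card (Y - cyc_interval n a x)" if "x \<in> {1..n}" for x
    using XY that unfolding rank_cond_iff[OF disjI2[OF refl] a Y] by auto
  \<comment> \<open>Passing to complements reverses the comparison, since \<open>Y\<close> and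
    \<open>B\<close> have the same size.\<close>
  have flip: "card (Y - C) \<le> card (B - C) \<longleftrightarrow> card (B \<inter> C) \<le> card (Y \<inter> C)" for C
    using card_Int_Diff[OF fin(1), of C] card_Int_Diff[OF fin(2), of C] B Y by linarith
  show ?thesis
    unfolding rank_cond_iff[OF disjI1[OF refl] a B]
      max_excess_iff_cyc[OF A(1) X(1) trans[OF A(2) X(2)[symmetric]] a]
      max_excess_iff_cyc[OF Y(1) B(1) trans[OF Y(2) B(2)[symmetric]] a]
    using rk flip by auto
qed

text \<open>Subadditivity bounds the counts of \<open>X\<close> in an interval and of
  \<open>Y\<close> outside it from below by \<open>k\<close> in total, which is
  \<open>X \<le>\<^sub>a Y\<close>.\<close>

lemma rank_cond_eq_imp_le:
  assumes a: "a \<in> {1..n}" and X: "X \<subseteq> {1..n}" "card X = k" and Y: "Y \<subseteq> {1..n}" "card Y = k"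
    and XY: "rank_cond (=) a X Y"
  shows "max_excess n X Y = pref_diff X Y a"
proof -
  have fin: "finite Y" using Y finite_subset by blast
  show ?thesis
    unfolding max_excess_iff_cyc[OF X(1) Y(1) trans[OF X(2) Y(2)[symmetric]] a]
  proof
    fix x assume x: "x \<in> {1..n}"
    let ?C = "cyc_interval n a x"
    have "r ?C = card (X \<inter> ?C)" "r ({1..n} - ?C) = card (Y - ?C)"
      using XY x unfolding rank_cond_iff[OF disjI2[OF refl] a Y] by auto
    then show "card (Y \<inter> ?C) \<le> card (X \<inter> ?C)"
      using rank_compl_ge[OF cyc_interval_subset[OF a x]] card_Int_Diff[OF fin, of ?C] Y by linarith
  qed
qed

text \<open>On the separator \<open>[a, b)\<close> the two bases at \<open>a\<close> have equally
  many elements, so they too have equal excess at \<open>a\<close> and \<open>b\<close>. Their rank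
  equalities carry over to \<open>b\<close>, where uniqueness identifies them.\<close>

lemma bases_rebase:
  assumes a: "a \<in> {1..n}" and b: "b \<in> {1..n}"
    and A: "A \<subseteq> {1..n}" "card A = k" and B: "B \<subseteq> {1..n}" "card B = k"
    and eq: "pref_diff A B a = pref_diff A B b" and le: "rank_cond (\<le>) a A B"
  shows "min_basis a = min_basis b" "max_basis a = max_basis b"
proof -
  let ?J = "cyc_interval n a b"
  let ?X = "min_basis a" and ?Y = "max_basis a"
  have fin: "finite ?Y" using bases_subset(2) finite_subset by blast
  have XY: "rank_cond (=) a ?X ?Y" by (rule rank_cond_bases[OF a])
  have "r ?J + r ({1..n} - ?J) = k" by (rule rank_cond_separator(1)[OF a b A B eq le])
  moreover have "r ?J = card (?X \<inter> ?J)" "r ({1..n} - ?J) = card (?Y - ?J)"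
    using XY b unfolding rank_cond_iff[OF disjI2[OF refl] a bases_subset(2) card_bases(2)[OF a]] by auto
  ultimately have "card (?Y \<inter> ?J) = card (?X \<inter> ?J)"
    using card_Int_Diff[OF fin, of ?J] card_bases(2)[OF a] by linarith
  then have "pref_diff ?X ?Y a = pref_diff ?X ?Y b"
    using pref_diff_cyc_interval[OF bases_subset(1,2) _ a b, of a a] card_bases[OF a] by simp
  then have "rank_cond (=) b ?X ?Y"
    using XY by (intro rank_cond_rebase[OF disjI2[OF refl] a b bases_subset(1) card_bases(1)[OF a]
        bases_subset(2) card_bases(2)[OF a]])
  then show "?X = min_basis b" "?Y = max_basis b"
    using rank_cond_unique[OF b bases_subset(1) card_bases(1)[OF a] bases_subset(2) card_bases(2)[OF a]
      bases_subset(1) card_bases(1)[OF b] bases_subset(2) card_bases(2)[OF b]] rank_cond_bases[OF b]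
    by blast+
qed

end

lemma flag_ground_rank:
  assumes F: "F \<in> complete_flags n" and k: "k \<le> n"
  shows "ground_rank n k (\<lambda>S. flag_rank n S F k) (in_flag_closure F k)"
  by unfold_locales (auto simp: flag_rank_empty[OF F k] flag_rank_full[OF F k, simplified]
      flag_rank_insert[OF F k, simplified] intro: in_flag_closure_mono)

section \<open>Chains of bases as permutations\<close>

text \<open>The \<open>k\<close>-th letter is the single element by which the chain grows at step
  \<open>k\<close>.\<close>

lemma permutation_of_chain:
  assumes c0: "c 0 = {}" and mono: "\<And>k. k < n \<Longrightarrow> c k \<subseteq> c (Suc k)"
    and card: "\<And>k. k \<le> n \<Longrightarrow> card (c k) = k" and sub: "\<And>k. k \<le> n \<Longrightarrow> c k \<subseteq> {1..n}"
  obtains w where "w permutes {1..n}" "\<And>k. k \<le> n \<Longrightarrow> w ` {1..k} = (c k :: nat set)"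
proof -
  have fin: "finite (c k)" if "k \<le> n" for k using sub[OF that] finite_subset by blast
  have "\<exists>z. c (Suc k) = insert z (c k)" if "k < n" for k
  proof -
    have "card (c (Suc k) - c k) = 1"
      using card_Diff_subset[OF fin mono[OF that]] card[of k] card[of "Suc k"] that by simp
    then obtain z where "c (Suc k) - c k = {z}" by (rule card_1_singletonE)
    then show ?thesis using mono[OF that] by (intro exI[of _ z]) blast
  qed
  then obtain g where g: "\<And>k. k < n \<Longrightarrow> c (Suc k) = insert (g k) (c k)" by metis
  define w where "w k = (if k \<in> {1..n} then g (k - 1) else k)" for k
  have img: "w ` {1..k} = c k" if "k \<le> n" for k
    using that
  proof (induction k)
    case 0
    then show ?case by (simp add: c0)
  next
    case (Suc k)
    have "w (Suc k) = g k" using Suc.prems by (simp add: w_def)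
    then show ?case using Suc g[of k] by (simp add: atLeastAtMostSuc_conv)
  qed
  have "c n = {1..n}" using sub[of n] card[of n] by (intro card_subset_eq) auto
  then have "bij_betw w {1..n} {1..n}"
    using img[of n] by (auto simp: bij_betw_def intro: eq_card_imp_inj_on)
  then have "w permutes {1..n}" by (rule bij_imp_permutes) (auto simp: w_def)
  then show ?thesis using that img by blast
qed

lemma permutation_eq_if_prefixes_eq:
  fixes w w' :: "nat \<Rightarrow> nat"
  assumes w: "w permutes {1..n}" and w': "w' permutes {1..n}"
    and eq: "\<And>k. k \<in> {1..n} \<Longrightarrow> w ` {1..k} = w' ` {1..k}"
  shows "w = w'"
proof
  fix i
  show "w i = w' i"
  proof (cases "i \<in> {1..n}")
    case True
    have diff: "p ` {1..i} - p ` {1..i - 1} = {p i}" if "p permutes {1..n}" for p :: "nat \<Rightarrow> nat"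
    proof -
      have "p ` {1..i} - p ` {1..i - 1} = p ` ({1..i} - {1..i - 1})"
        by (rule image_set_diff[symmetric, OF permutes_inj[OF that]])
      also have "{1..i} - {1..i - 1} = {i}" using True by auto
      finally show ?thesis by simp
    qed
    have "w ` {1..i - 1} = w' ` {1..i - 1}"
    proof (cases "i = 1")
      case False
      then show ?thesis using eq[of "i - 1"] True by force
    qed simp
    then show ?thesis using diff[OF w] diff[OF w'] eq[OF True] by simp
  next
    case False
    then show ?thesis using permutes_not_in[OF w] permutes_not_in[OF w'] by simp
  qed
qed

section \<open>Rank conditions on flags and the strata\<close>

abbreviation flag_cond where
  "flag_cond n F R k a A B \<equiv> ground_rank.rank_cond n (\<lambda>S. flag_rank n S F k) R a A B"

lemma tilted_richardson_iff:
  "F \<in> tilted_richardson n u v \<longleftrightarrow> F \<in> complete_flags n \<and>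
     (\<forall>k\<in>{1..n}. flag_cond n F (\<le>) k (choose_shift n u v k) (u ` {1..k}) (v ` {1..k}))"
  if "F \<in> complete_flags n"
proof -
  have "flag_cond n F (\<le>) k a A B \<longleftrightarrow> (\<forall>i\<in>{1..n}.
     flag_rank n (cyc_interval n a i) F k \<le> card (A \<inter> cyc_interval n a i) \<and>
     flag_rank n (cyc_interval n i a) F k \<le> card (B \<inter> cyc_interval n i a))" if "k \<in> {1..n}" for k a A B
    using that \<open>F \<in> complete_flags n\<close>
    by (intro ground_rank.rank_cond_def[OF flag_ground_rank]) auto
  then show ?thesis unfolding tilted_richardson_def Let_def by blast
qed

lemma open_tilted_richardson_iff:
  "F \<in> open_tilted_richardson n u v \<longleftrightarrow> F \<in> complete_flags n \<and>
     (\<forall>k\<in>{1..n}. flag_cond n F (=) k (choose_shift n u v k) (u ` {1..k}) (v ` {1..k}))"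
  if "F \<in> complete_flags n"
proof -
  have "flag_cond n F (=) k a A B \<longleftrightarrow> (\<forall>i\<in>{1..n}.
     flag_rank n (cyc_interval n a i) F k = card (A \<inter> cyc_interval n a i) \<and>
     flag_rank n (cyc_interval n i a) F k = card (B \<inter> cyc_interval n i a))" if "k \<in> {1..n}" for k a A B
    using that \<open>F \<in> complete_flags n\<close>
    by (intro ground_rank.rank_cond_def[OF flag_ground_rank]) auto
  then show ?thesis unfolding open_tilted_richardson_def Let_def by blast
qed

text \<open>Both shifts maximise the same excess, so \<open>rank_cond_rebase\<close> applies. This
  lets the strata of all subintervals be described by the shift chosen for \<open>u\<close> and
  \<open>v\<close>.\<close>

lemma open_tilted_richardson_any_shift:
  assumes F: "F \<in> complete_flags n" and x: "x permutes {1..n}" and y: "y permutes {1..n}"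
    and a: "a \<in> {1..n} \<rightarrow> {1..n}" and xy: "perm_le n a x y"
  shows "F \<in> open_tilted_richardson n x y \<longleftrightarrow>
    (\<forall>k\<in>{1..n}. flag_cond n F (=) k (a k) (x ` {1..k}) (y ` {1..k}))"
proof -
  let ?b = "choose_shift n x y"
  have b: "?b \<in> {1..n} \<rightarrow> {1..n}" "perm_le n ?b x y" by (rule choose_shift[OF x y])+
  have "flag_cond n F (=) k (?b k) (x ` {1..k}) (y ` {1..k}) \<longleftrightarrow>
      flag_cond n F (=) k (a k) (x ` {1..k}) (y ` {1..k})" if k: "k \<in> {1..n}" for k
  proof -
    have kn: "k \<le> n" using k by simp
    interpret ground_rank n k "\<lambda>S. flag_rank n S F k" "in_flag_closure F k"
      by (rule flag_ground_rank[OF F kn])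
    have ak: "a k \<in> {1..n}" "?b k \<in> {1..n}" using funcset_mem[OF a k] funcset_mem[OF b(1) k] .
    have eq: "pref_diff (x ` {1..k}) (y ` {1..k}) (a k) = pref_diff (x ` {1..k}) (y ` {1..k}) (?b k)"
      using xy b(2) k unfolding perm_le_iff[OF a x y] perm_le_iff[OF b(1) x y] by metis
    note sets = prefix_subset[OF x kn] prefix_card[OF x] prefix_subset[OF y kn] prefix_card[OF y]
    show ?thesis
      using rank_cond_rebase[OF disjI2[OF refl] ak(1,2) sets eq]
        rank_cond_rebase[OF disjI2[OF refl] ak(2,1) sets eq[symmetric]] by blast
  qed
  then show ?thesis unfolding open_tilted_richardson_iff[OF F] using F by blast
qed

text \<open>The shifts admissible for the \<open>k\<close>-th prefixes are the positions where their excess is maximal,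
  so one of the two shifts \<open>a k\<close> and \<open>a (Suc k)\<close> serves both \<open>k\<close> and \<open>Suc k\<close>.\<close>

lemma consecutive_shifts:
  assumes u: "u permutes {1..n}" and v: "v permutes {1..n}" and a: "a \<in> {1..n} \<rightarrow> {1..n}"
    and uv: "perm_le n a u v" and k: "k \<in> {1..n}" "Suc k \<in> {1..n}"
  shows "pref_diff (u ` {1..k}) (v ` {1..k}) (a k) = pref_diff (u ` {1..k}) (v ` {1..k}) (a (Suc k)) \<or>
    pref_diff (u ` {1..Suc k}) (v ` {1..Suc k}) (a (Suc k)) = pref_diff (u ` {1..Suc k}) (v ` {1..Suc k}) (a k)"
proof -
  have ak: "a k \<in> {1..n}" "a (Suc k) \<in> {1..n}" using funcset_mem[OF a] k by blast+
  have count: "card (w ` {1..Suc k} \<inter> {1..<x}) = card (w ` {1..k} \<inter> {1..<x}) + (if w (Suc k) < x then 1 else 0)"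
    if w: "w permutes {1..n}" for w :: "nat \<Rightarrow> nat" and x
  proof -
    have "w ` {1..Suc k} = insert (w (Suc k)) (w ` {1..k})" by (simp add: atLeastAtMostSuc_conv)
    moreover have "w (Suc k) \<notin> w ` {1..k}" by (simp add: inj_image_mem_iff[OF permutes_inj[OF w]])
    moreover have "w (Suc k) \<in> {1..n}" using permutes_in_image[OF w] k by blast
    ultimately show ?thesis by (auto simp: Int_insert_left)
  qed
  let ?P = "\<lambda>k. pref_diff (u ` {1..k}) (v ` {1..k})"
  have step: "?P (Suc k) x = ?P k x + (if v (Suc k) < x then 1 else 0) - (if u (Suc k) < x then 1 else 0)" for x
    unfolding pref_diff_def count[OF u] count[OF v] by simp
  \<comment> \<open>Passing to \<open>Suc k\<close> adds a function of \<open>x\<close> whose values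
    differ by at most 1. These two nonnegative gaps sum to a difference of such values, so one of
    them is zero.\<close>
  have "?P k (a (Suc k)) \<le> ?P k (a k)" "?P (Suc k) (a k) \<le> ?P (Suc k) (a (Suc k))"
    using uv k max_excess_ge[OF ak(2), of "u ` {1..k}" "v ` {1..k}"]
      max_excess_ge[OF ak(1), of "u ` {1..Suc k}" "v ` {1..Suc k}"]
    unfolding perm_le_iff[OF a u v] by (metis)+
  then show ?thesis unfolding step by (auto split: if_splits)
qed

text \<open>With a common shift the greedy tests use the same sets, and the closure for
  \<open>F (Suc k)\<close> is contained in that for \<open>F k\<close>.\<close>

lemma bases_Suc:
  assumes F: "F \<in> complete_flags n" and k: "k < n"
  shows "ground_rank.min_basis n (in_flag_closure F k) a \<subseteq> ground_rank.min_basis n (in_flag_closure F (Suc k)) a"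
    "ground_rank.max_basis n (in_flag_closure F k) a \<subseteq> ground_rank.max_basis n (in_flag_closure F (Suc k)) a"
proof -
  interpret L: ground_rank n k "\<lambda>S. flag_rank n S F k" "in_flag_closure F k"
    by (rule flag_ground_rank[OF F]) (use k in simp)
  interpret H: ground_rank n "Suc k" "\<lambda>S. flag_rank n S F (Suc k)" "in_flag_closure F (Suc k)"
    by (rule flag_ground_rank[OF F]) (use k in simp)
  show "L.min_basis a \<subseteq> H.min_basis a" "L.max_basis a \<subseteq> H.max_basis a"
    unfolding L.min_basis_def H.min_basis_def L.max_basis_def H.max_basis_def
      L.greedy_basis_def H.greedy_basis_def
    using in_flag_closure_Suc[OF F k] by blast+
qed

text \<open>By \<open>consecutive_shifts\<close> and \<open>bases_rebase\<close>, the bases for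
  \<open>k\<close> and \<open>Suc k\<close> can be taken with a common shift, so they are nested and
  form the prefixes of a permutation.\<close>

lemma tilted_richardson_bases:
  assumes F: "F \<in> tilted_richardson n u v" and u: "u permutes {1..n}" and v: "v permutes {1..n}"
  defines "a \<equiv> choose_shift n u v"
  obtains x y where "x permutes {1..n}" "y permutes {1..n}"
    "\<And>k. k \<in> {1..n} \<Longrightarrow> x ` {1..k} = ground_rank.min_basis n (in_flag_closure F k) (a k)"
    "\<And>k. k \<in> {1..n} \<Longrightarrow> y ` {1..k} = ground_rank.max_basis n (in_flag_closure F k) (a k)"
proof -
  have Fc: "F \<in> complete_flags n" using F by (simp add: tilted_richardson_def Let_def)
  have a: "a \<in> {1..n} \<rightarrow> {1..n}" and uv: "perm_le n a u v"
    unfolding a_def by (rule choose_shift[OF u v])+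
  have cond: "flag_cond n F (\<le>) k (a k) (u ` {1..k}) (v ` {1..k})" if "k \<in> {1..n}" for k
    using F that unfolding tilted_richardson_iff[OF Fc] a_def by blast
  let ?X = "\<lambda>k b. ground_rank.min_basis n (in_flag_closure F k) b"
  let ?Y = "\<lambda>k b. ground_rank.max_basis n (in_flag_closure F k) b"
  have ak: "a k \<in> {1..n}" if "k \<in> {1..n}" for k using funcset_mem[OF a that] .
  have basis: "?X k b \<subseteq> {1..n}" "?Y k b \<subseteq> {1..n}" "b \<in> {1..n} \<Longrightarrow> card (?X k b) = k"
    "b \<in> {1..n} \<Longrightarrow> card (?Y k b) = k" if "k \<in> {1..n}" for k b
    using that ground_rank.bases_subset[OF flag_ground_rank[OF Fc, of k]]
      ground_rank.card_bases[OF flag_ground_rank[OF Fc, of k]] by auto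
  have rebase: "?X k (a k) = ?X k b" "?Y k (a k) = ?Y k b"
    if "k \<in> {1..n}" "b \<in> {1..n}"
      "pref_diff (u ` {1..k}) (v ` {1..k}) (a k) = pref_diff (u ` {1..k}) (v ` {1..k}) b" for k b
  proof -
    have kn: "k \<le> n" using that by simp
    show "?X k (a k) = ?X k b" "?Y k (a k) = ?Y k b"
      by (rule ground_rank.bases_rebase[OF flag_ground_rank[OF Fc kn] ak[OF that(1)] that(2)
          prefix_subset[OF u kn] prefix_card[OF u] prefix_subset[OF v kn] prefix_card[OF v]
          that(3) cond[OF that(1)]])+
  qed
  have nested: "?X k (a k) \<subseteq> ?X (Suc k) (a (Suc k)) \<and> ?Y k (a k) \<subseteq> ?Y (Suc k) (a (Suc k))"
    if "1 \<le> k" "k < n" for k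
  proof -
    have k: "k \<in> {1..n}" "Suc k \<in> {1..n}" using that by auto
    note sub = bases_Suc[OF Fc that(2)]
    from consecutive_shifts[OF u v a uv k] show ?thesis
    proof
      assume "pref_diff (u ` {1..k}) (v ` {1..k}) (a k) = pref_diff (u ` {1..k}) (v ` {1..k}) (a (Suc k))"
      then show ?thesis using rebase[OF k(1) ak[OF k(2)]] sub[of "a (Suc k)"] by simp
    next
      assume "pref_diff (u ` {1..Suc k}) (v ` {1..Suc k}) (a (Suc k)) =
        pref_diff (u ` {1..Suc k}) (v ` {1..Suc k}) (a k)"
      then show ?thesis using rebase[OF k(2) ak[OF k(1)]] sub[of "a k"] by simp
    qed
  qed
  have chain: "\<exists>w. w permutes {1..n} \<and> (\<forall>k\<in>{1..n}. w ` {1..k} = Z k)"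
    if Z: "\<And>k. k \<in> {1..n} \<Longrightarrow> Z k \<subseteq> {1..n} \<and> card (Z k) = k"
      "\<And>k. 1 \<le> k \<Longrightarrow> k < n \<Longrightarrow> Z k \<subseteq> Z (Suc k)" for Z :: "nat \<Rightarrow> nat set"
  proof -
    \<comment> \<open>The chain is completed by the empty set, as \<open>Z\<close> is only
      controlled from 1 on.\<close>
    define c where "c k = (if k = 0 then {} else Z k)" for k
    obtain w where "w permutes {1..n}" "\<And>k. k \<le> n \<Longrightarrow> w ` {1..k} = c k"
    proof (rule permutation_of_chain[of c n])
      show "c k \<subseteq> c (Suc k)" if "k < n" for k using Z(2)[of k] that by (auto simp: c_def)
      show "card (c k) = k" if "k \<le> n" for k using Z(1)[of k] that by (auto simp: c_def)
      show "c k \<subseteq> {1..n}" if "k \<le> n" for k using Z(1)[of k] that unfolding c_def by (cases "k = 0") auto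
    qed (auto simp: c_def)
    then show ?thesis by (intro exI[of _ w]) (auto simp: c_def)
  qed
  have "\<exists>x. x permutes {1..n} \<and> (\<forall>k\<in>{1..n}. x ` {1..k} = ?X k (a k))"
  proof (rule chain)
    show "?X k (a k) \<subseteq> {1..n} \<and> card (?X k (a k)) = k" if "k \<in> {1..n}" for k
      using basis(1)[OF that] basis(3)[OF that ak[OF that]] by (rule conjI)
    show "?X k (a k) \<subseteq> ?X (Suc k) (a (Suc k))" if "1 \<le> k" "k < n" for k
      using nested[OF that] by (rule conjunct1)
  qed
  then obtain x where x: "x permutes {1..n}" "\<forall>k\<in>{1..n}. x ` {1..k} = ?X k (a k)"
    by (elim exE conjE)
  have "\<exists>y. y permutes {1..n} \<and> (\<forall>k\<in>{1..n}. y ` {1..k} = ?Y k (a k))"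
  proof (rule chain)
    show "?Y k (a k) \<subseteq> {1..n} \<and> card (?Y k (a k)) = k" if "k \<in> {1..n}" for k
      using basis(2)[OF that] basis(4)[OF that ak[OF that]] by (rule conjI)
    show "?Y k (a k) \<subseteq> ?Y (Suc k) (a (Suc k))" if "1 \<le> k" "k < n" for k
      using nested[OF that] by (rule conjunct2)
  qed
  then obtain y where y: "y permutes {1..n}" "\<forall>k\<in>{1..n}. y ` {1..k} = ?Y k (a k)"
    by (elim exE conjE)
  show ?thesis
    by (rule that[OF x(1) y(1) bspec[OF x(2)] bspec[OF y(2)]])
qed

text \<open>\<open>rank_cond_le_iff\<close> for every \<open>k\<close>, with \<open>x\<close> and
  \<open>y\<close> supplying the exact ranks. It serves both inclusions of the
  stratification.\<close>

lemma tilted_richardson_iff_bounds: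
  assumes F: "F \<in> complete_flags n" and u: "u permutes {1..n}" and v: "v permutes {1..n}"
    and x: "x permutes {1..n}" and y: "y permutes {1..n}"
  defines "a \<equiv> choose_shift n u v"
  assumes xy: "\<And>k. k \<in> {1..n} \<Longrightarrow> flag_cond n F (=) k (a k) (x ` {1..k}) (y ` {1..k})"
  shows "F \<in> tilted_richardson n u v \<longleftrightarrow> perm_le n a u x \<and> perm_le n a y v"
proof -
  have a: "a \<in> {1..n} \<rightarrow> {1..n}" unfolding a_def by (rule choose_shift[OF u v])
  have "flag_cond n F (\<le>) k (a k) (u ` {1..k}) (v ` {1..k}) \<longleftrightarrow>
     max_excess n (u ` {1..k}) (x ` {1..k}) = pref_diff (u ` {1..k}) (x ` {1..k}) (a k) \<and>
     max_excess n (y ` {1..k}) (v ` {1..k}) = pref_diff (y ` {1..k}) (v ` {1..k}) (a k)"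
    if k: "k \<in> {1..n}" for k
  proof -
    have kn: "k \<le> n" using k by simp
    show ?thesis
      by (rule ground_rank.rank_cond_le_iff[OF flag_ground_rank[OF F kn] funcset_mem[OF a k]
          prefix_subset[OF u kn] prefix_card[OF u] prefix_subset[OF v kn] prefix_card[OF v]
          prefix_subset[OF x kn] prefix_card[OF x] prefix_subset[OF y kn] prefix_card[OF y] xy[OF k]])
  qed
  then show ?thesis
    unfolding tilted_richardson_iff[OF F] a_def[symmetric] perm_le_iff[OF a u x] perm_le_iff[OF a y v]
    using F by blast
qed

theorem theorem5p1:
  fixes n :: nat and u v :: "nat \<Rightarrow> nat"
  assumes "u permutes {1..n}" and "v permutes {1..n}"
  shows "tilted_richardson n u v =
           (\<Union>(x, y) \<in> {(x, y). x \<in> tilted_interval n u v \<and> y \<in> tilted_interval n u v \<and>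
                             tilted_le n u v x y}.
              open_tilted_richardson n x y) \<and>
         disjoint_family_on (\<lambda>(x, y). open_tilted_richardson n x y)
           {(x, y). x \<in> tilted_interval n u v \<and> y \<in> tilted_interval n u v \<and> tilted_le n u v x y}"
proof -
  note u = assms(1) and v = assms(2)
  define a where "a = choose_shift n u v"
  have a: "a \<in> {1..n} \<rightarrow> {1..n}" and uv: "perm_le n a u v"
    unfolding a_def by (rule choose_shift[OF u v])+
  define J where "J = {(x, y). x \<in> tilted_interval n u v \<and> y \<in> tilted_interval n u v \<and> tilted_le n u v x y}"
  have I: "(x, y) \<in> J \<longleftrightarrow> x permutes {1..n} \<and> y permutes {1..n} \<and>
      perm_le n a u x \<and> perm_le n a x y \<and> perm_le n a y v" for x y
    unfolding J_def using tilted_le_iff[OF a uv u v] by simp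
  have open_flags: "F \<in> complete_flags n" if "F \<in> open_tilted_richardson n x y" for F x y
    using that by (simp add: open_tilted_richardson_def Let_def)
  \<comment> \<open>All strata are expressed with the same \<open>a\<close>, which makes them
    comparable with each other and with the closed variety.\<close>
  have open_cond: "flag_cond n F (=) k (a k) (x ` {1..k}) (y ` {1..k})"
    if "(x, y) \<in> J" "F \<in> open_tilted_richardson n x y" "k \<in> {1..n}" for F x y k
    using that open_tilted_richardson_any_shift[OF open_flags[OF that(2)] _ _ a, of x y] unfolding I by blast
  have "\<exists>x y. (x, y) \<in> J \<and> F \<in> open_tilted_richardson n x y" if F: "F \<in> tilted_richardson n u v" for F
  proof -
    have Fc: "F \<in> complete_flags n" using F by (simp add: tilted_richardson_def Let_def)
    obtain x y where x: "x permutes {1..n}" and y: "y permutes {1..n}"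
      and X: "\<And>k. k \<in> {1..n} \<Longrightarrow> x ` {1..k} = ground_rank.min_basis n (in_flag_closure F k) (a k)"
      and Y: "\<And>k. k \<in> {1..n} \<Longrightarrow> y ` {1..k} = ground_rank.max_basis n (in_flag_closure F k) (a k)"
      using tilted_richardson_bases[OF F u v, folded a_def] by blast
    have xy: "flag_cond n F (=) k (a k) (x ` {1..k}) (y ` {1..k})" if k: "k \<in> {1..n}" for k
      unfolding X[OF k] Y[OF k]
      by (rule ground_rank.rank_cond_bases[OF flag_ground_rank[OF Fc] funcset_mem[OF a k]]) (use k in simp)
    have le: "perm_le n a x y"
      unfolding perm_le_iff[OF a x y]
    proof
      fix k assume k: "k \<in> {1..n}"
      then have kn: "k \<le> n" by simp
      show "max_excess n (x ` {1..k}) (y ` {1..k}) = pref_diff (x ` {1..k}) (y ` {1..k}) (a k)"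
        by (rule ground_rank.rank_cond_eq_imp_le[OF flag_ground_rank[OF Fc kn] funcset_mem[OF a k]
            prefix_subset[OF x kn] prefix_card[OF x] prefix_subset[OF y kn] prefix_card[OF y] xy[OF k]])
    qed
    have "perm_le n a u x \<and> perm_le n a y v"
      using tilted_richardson_iff_bounds[OF Fc u v x y] xy F unfolding a_def by blast
    then have "(x, y) \<in> J" unfolding I using x y le by blast
    moreover have "F \<in> open_tilted_richardson n x y"
      using open_tilted_richardson_any_shift[OF Fc x y a le] xy by blast
    ultimately show ?thesis by blast
  qed
  moreover have "F \<in> tilted_richardson n u v"
    if xy: "(x, y) \<in> J" and F: "F \<in> open_tilted_richardson n x y" for F x y
    using tilted_richardson_iff_bounds[OF open_flags[OF F] u v, of x y] open_cond[OF xy F] xy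
    unfolding I a_def by blast
  ultimately have "tilted_richardson n u v = (\<Union>(x, y) \<in> J. open_tilted_richardson n x y)"
    by blast
  moreover have "disjoint_family_on (\<lambda>(x, y). open_tilted_richardson n x y) J"
  proof -
    \<comment> \<open>A flag determines its pair: by \<open>rank_cond_unique\<close> its ranks fix
      every prefix of both permutations.\<close>
    have "(x, y) = (x', y')" if xy: "(x, y) \<in> J" "(x', y') \<in> J"
      and F: "F \<in> open_tilted_richardson n x y" "F \<in> open_tilted_richardson n x' y'" for x y x' y' F
    proof -
      have p: "x permutes {1..n}" "y permutes {1..n}" "x' permutes {1..n}" "y' permutes {1..n}"
        using xy unfolding I by blast+
      have "x ` {1..k} = x' ` {1..k} \<and> y ` {1..k} = y' ` {1..k}" if k: "k \<in> {1..n}" for k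
      proof -
        have kn: "k \<le> n" using k by simp
        show ?thesis
          using ground_rank.rank_cond_unique[OF flag_ground_rank[OF open_flags[OF F(1)] kn]
              funcset_mem[OF a k] prefix_subset[OF p(1) kn] prefix_card[OF p(1)]
              prefix_subset[OF p(2) kn] prefix_card[OF p(2)] prefix_subset[OF p(3) kn] prefix_card[OF p(3)]
              prefix_subset[OF p(4) kn] prefix_card[OF p(4)] open_cond[OF xy(1) F(1) k] open_cond[OF xy(2) F(2) k]]
          by blast
      qed
      then show ?thesis using permutation_eq_if_prefixes_eq[OF p(1,3)] permutation_eq_if_prefixes_eq[OF p(2,4)] by blast
    qed
    then show ?thesis unfolding disjoint_family_on_def by fast
  qed
  ultimately show ?thesis unfolding J_def by (rule conjI)
qed

end
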